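(* Let $p\in[1,\infty)$ and let $A$ be a unital $L^p$-operator algebra. Let $A_{\mathrm h}$ denote the set of hermitian elements of $A$ and set $\mathrm{core}(A):=A_{\mathrm h}+iA_{\mathrm h}$. Then $\mathrm{core}(A)$ is the largest unital $C^*$-subalgebra of $A$ (that is, it is a unital $C^*$-subalgebra of $A$ and it contains every unital $C^*$-subalgebra of $A$; in particular it is the unique maximal unital $C^*$-subalgebra of $A$). If $p\neq 2$, then $\mathrm{core}(A)$ is commutative.
   Context: All Banach algebras are complex, and units of unital Banach algebras have norm $1$. An $L^p$-space is a Banach space of the form $L^p(X,\Sigma,\mu)$ for some measure space. A Banach algebra is an $L^p$-operator algebra if it admits an isometric representation (isometric algebra homomorphism) into $\mathcal B(L^p(\mu))$, the bounded operators on some $L^p$-space. An element $a$ of a unital Banach algebra $A$ is hermitian if $\|e^{ita}\|=1$ for all $t\in\mathbb R$; $A_{\mathrm h}$ is the set of hermitian elements, a closed real-linear subspace with $A_{\mathrm h}\cap iA_{\mathrm h}=\{0\}$. A unital (i.e. containing the unit of $A$) closed subalgebra $B\subseteq A$ is called a unital $C^*$-subalgebra of $A$ if $B=B_{\mathrm h}+iB_{\mathrm h}$ (by the Vidav--Palmer theorem, $B$ is then a $C^*$-algebra with involution $x+iy\mapsto x-iy$ for $x,y\in B_{\mathrm h}$). *)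

theory Defs
  imports "HOL-Analysis.Analysis"
begin

section \<open>Unital complex Banach algebras\<close>

text \<open>The library only has real Banach algebras. The axiom \<open>scaleC_of_real\<close> makes the real
  structure of the superclasses the restriction of the complex one; \<open>norm 1 = 1\<close> and
  completeness are inherited.\<close>

class complex_banach_algebra_1 = real_normed_algebra_1 + banach +
  fixes scaleC :: "complex \<Rightarrow> 'a \<Rightarrow> 'a" (infixr "*\<^sub>C" 75)
  assumes scaleC_add_right: "c *\<^sub>C (x + y) = c *\<^sub>C x + c *\<^sub>C y"
    and scaleC_add_left: "(c + d) *\<^sub>C x = c *\<^sub>C x + d *\<^sub>C x"
    and scaleC_scaleC: "c *\<^sub>C (d *\<^sub>C x) = (c * d) *\<^sub>C x"
    and scaleC_of_real: "complex_of_real r *\<^sub>C x = r *\<^sub>R x"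
    and mult_scaleC_left: "(c *\<^sub>C x) * y = c *\<^sub>C (x * y)"
    and mult_scaleC_right: "x * (c *\<^sub>C y) = c *\<^sub>C (x * y)"
    and norm_scaleC: "norm (c *\<^sub>C x) = cmod c * norm x"

definition hermitian :: "'a::complex_banach_algebra_1 \<Rightarrow> bool" where
  "hermitian a \<longleftrightarrow> (\<forall>t::real. norm (exp ((\<i> * complex_of_real t) *\<^sub>C a)) = 1)"

text \<open>For a closed subalgebra \<open>B\<close> containing 1, the exponential series of an element of \<open>B\<close>
  has the same sum in \<open>B\<close> as in the ambient algebra, so this is the set of hermitian elements
  of the Banach algebra \<open>B\<close>.\<close>

definition hermitian_elements :: "'a::complex_banach_algebra_1 set \<Rightarrow> 'a set" where
  "hermitian_elements B = {a \<in> B. hermitian a}"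

definition core :: "'a::complex_banach_algebra_1 set \<Rightarrow> 'a set" where
  "core B = {x + \<i> *\<^sub>C y | x y. x \<in> hermitian_elements B \<and> y \<in> hermitian_elements B}"

definition unital_closed_subalgebra :: "'a::complex_banach_algebra_1 set \<Rightarrow> bool" where
  "unital_closed_subalgebra B \<longleftrightarrow>
     closed B \<and> 1 \<in> B \<and>
     (\<forall>x\<in>B. \<forall>y\<in>B. x + y \<in> B) \<and>
     (\<forall>c. \<forall>x\<in>B. c *\<^sub>C x \<in> B) \<and>
     (\<forall>x\<in>B. \<forall>y\<in>B. x * y \<in> B)"

definition unital_Cstar_subalgebra :: "'a::complex_banach_algebra_1 set \<Rightarrow> bool" where
  "unital_Cstar_subalgebra B \<longleftrightarrow> unital_closed_subalgebra B \<and> B = core B"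


section \<open>Complex Lp-spaces\<close>

definition Lp_fun :: "real \<Rightarrow> 'x measure \<Rightarrow> ('x \<Rightarrow> complex) set" where
  "Lp_fun p M = {f \<in> borel_measurable M. integrable M (\<lambda>x. cmod (f x) powr p)}"

definition Lp_rel :: "real \<Rightarrow> 'x measure \<Rightarrow> (('x \<Rightarrow> complex) \<times> ('x \<Rightarrow> complex)) set" where
  "Lp_rel p M = {(f, g). f \<in> Lp_fun p M \<and> g \<in> Lp_fun p M \<and> (AE x in M. f x = g x)}"

definition Lp_space :: "real \<Rightarrow> 'x measure \<Rightarrow> ('x \<Rightarrow> complex) set set" where
  "Lp_space p M = Lp_fun p M // Lp_rel p M"

definition Lp_add ::
    "real \<Rightarrow> 'x measure \<Rightarrow> ('x \<Rightarrow> complex) set \<Rightarrow> ('x \<Rightarrow> complex) set \<Rightarrow> ('x \<Rightarrow> complex) set" where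
  "Lp_add p M X Y = (\<Union>f\<in>X. \<Union>g\<in>Y. Lp_rel p M `` {\<lambda>x. f x + g x})"

definition Lp_scale ::
    "real \<Rightarrow> 'x measure \<Rightarrow> complex \<Rightarrow> ('x \<Rightarrow> complex) set \<Rightarrow> ('x \<Rightarrow> complex) set" where
  "Lp_scale p M c X = (\<Union>f\<in>X. Lp_rel p M `` {\<lambda>x. c * f x})"

text \<open>The image below is a singleton, as the integral depends only on the class.\<close>

definition Lp_norm :: "real \<Rightarrow> 'x measure \<Rightarrow> ('x \<Rightarrow> complex) set \<Rightarrow> real" where
  "Lp_norm p M X = the_elem ((\<lambda>f. (\<integral>x. cmod (f x) powr p \<partial>M) powr (1 / p)) ` X)"


section \<open>Bounded operators on Lp-spaces and isometric representations\<close>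

definition Lp_bounded_operator ::
    "real \<Rightarrow> 'x measure \<Rightarrow> (('x \<Rightarrow> complex) set \<Rightarrow> ('x \<Rightarrow> complex) set) \<Rightarrow> bool" where
  "Lp_bounded_operator p M T \<longleftrightarrow>
     (\<forall>X\<in>Lp_space p M. T X \<in> Lp_space p M) \<and>
     (\<forall>X\<in>Lp_space p M. \<forall>Y\<in>Lp_space p M. T (Lp_add p M X Y) = Lp_add p M (T X) (T Y)) \<and>
     (\<forall>c. \<forall>X\<in>Lp_space p M. T (Lp_scale p M c X) = Lp_scale p M c (T X)) \<and>
     (\<exists>K. \<forall>X\<in>Lp_space p M. Lp_norm p M (T X) \<le> K * Lp_norm p M X)"

text \<open>As in the library's \<^const>\<open>onorm\<close>, the zero vector contributes \<open>0 / 0 = 0\<close>.\<close>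

definition Lp_onorm ::
    "real \<Rightarrow> 'x measure \<Rightarrow> (('x \<Rightarrow> complex) set \<Rightarrow> ('x \<Rightarrow> complex) set) \<Rightarrow> real" where
  "Lp_onorm p M T = (SUP X\<in>Lp_space p M. Lp_norm p M (T X) / Lp_norm p M X)"

text \<open>Operators are compared on \<^const>\<open>Lp_space\<close> only; their values elsewhere are junk.
  A representation is not required to be unital: \<open>\<phi> 1\<close> may be a proper idempotent.\<close>

definition isometric_representation ::
    "real \<Rightarrow> 'x measure \<Rightarrow>
     ('a::complex_banach_algebra_1 \<Rightarrow> ('x \<Rightarrow> complex) set \<Rightarrow> ('x \<Rightarrow> complex) set) \<Rightarrow> bool" where
  "isometric_representation p M \<phi> \<longleftrightarrow>
     (\<forall>a. Lp_bounded_operator p M (\<phi> a)) \<and>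
     (\<forall>a b. \<forall>X\<in>Lp_space p M. \<phi> (a + b) X = Lp_add p M (\<phi> a X) (\<phi> b X)) \<and>
     (\<forall>c a. \<forall>X\<in>Lp_space p M. \<phi> (c *\<^sub>C a) X = Lp_scale p M c (\<phi> a X)) \<and>
     (\<forall>a b. \<forall>X\<in>Lp_space p M. \<phi> (a * b) X = \<phi> a (\<phi> b X)) \<and>
     (\<forall>a. Lp_onorm p M (\<phi> a) = norm a)"

end

(* Let P be a contractive idempotent on L^p, p \<noteq> 2, with range E, and let J z = |z|^(p-1) sgn (cnj z) be the
   derivative of the norm. For p > 1 a function f lies in E iff J f annihilates the kernel of P, so both E
   and J(E) are linear; differentiating J(f + e g) at e = 0 then yields |f| sgn g in E for f, g in E. For
   p = 1 equality in the triangle inequality replaces this argument. Consequently the restriction of an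
   element of E to the support of another one stays in E.

   By Lumer's criterion, an element is hermitian iff the integral of (T f) (J f) is real for all f in E.
   For p \<noteq> 2, applying this to f + c g with disjointly supported f, g and varying |c| shows that hermitian
   operators preserve supports and hence multiply each f in E by a real function. So they commute, their
   products are hermitian, and |T f| \<le> |T f + i S f|, which makes the core a closed subalgebra. For p = 2 the
   criterion says that hermitian operators are symmetric on E; then a b + b a and i (a b - b a) are hermitian,
   and a - i b is the adjoint of a + i b and has the same norm. *)

theory Submission
  imports Defs "HOL-Real_Asymp.Real_Asymp"
begin

section \<open>The duality map of \<open>L\<^sup>p\<close>\<close>

text \<open>The idempotent P is the image of the unit: a representation need not be unital, so the
  operators live on the range E of P, which may be a small subspace of L^p. Multiplication by an
  indicator function need not preserve E, so the only cut-offs available are those to supports of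
  elements of E. For \<open>p = 2\<close> even these can leave E, which is why that exponent is
  treated apart. Differentiating J is done for exponents above 2. Since J maps E into the
  annihilator of the kernel of P in the conjugate L^q, and the inverse of J maps this annihilator
  back, exponents between 1 and 2 are reached by exchanging the two spaces. One first-order
  inequality, the tangent bound for the convex function |z|^p, recurs throughout: it yields the
  orthogonality of J f to the kernel, the bound on the numerical range, both directions of Lumer's
  criterion and, for \<open>p = 2\<close>, the norm bound for the adjoint. The measure is arbitrary,
  so functionals occur only as explicit integrals against J f.\<close>

definition dualp :: "real \<Rightarrow> complex \<Rightarrow> complex" where
  "dualp p z = cnj (sgn z) * of_real (cmod z powr (p - 1))"

lemma dualp_0 [simp]: "dualp p 0 = 0"
  by (simp add: dualp_def)

lemma cmod_dualp: "cmod (dualp p z) = cmod z powr (p - 1)"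
  by (cases "z = 0") (simp_all add: dualp_def norm_mult norm_sgn)

lemma mult_dualp: "z * dualp p z = of_real (cmod z powr p)"
proof (cases "z = 0")
  case False
  have "z * cnj (sgn z) = of_real (cmod z)"
    using False by (simp add: sgn_eq complex_norm_square [symmetric] power2_eq_square)
  moreover have "cmod z * cmod z powr (p - 1) = cmod z powr p"
    using False by (simp add: powr_diff)
  ultimately show ?thesis
    unfolding dualp_def by (metis mult.assoc of_real_mult)
qed simp

lemma dualp_mult: "dualp p (c * z) = dualp p c * dualp p z"
  by (simp add: dualp_def sgn_mult norm_mult powr_mult)

lemma dualp_2: "dualp 2 z = cnj z"
  by (cases "z = 0") (simp_all add: dualp_def sgn_eq)

text \<open>A real-linear factor times a power that is continuous at 0: the form in which
  differences and derivatives of \<open>dualp p\<close> are estimated.\<close>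

lemma dualp_eq_cnj: "2 < p \<Longrightarrow> dualp p z = cnj z * of_real (cmod z powr (p - 2))"
proof (cases "z = 0")
  case False
  assume "2 < p"
  have "cmod z powr (p - 1) = cmod z * cmod z powr (p - 2)"
    using False powr_add [of "cmod z" 1 "p - 2"] by (simp add: algebra_simps)
  then show ?thesis
    using False by (simp add: dualp_def sgn_eq)
qed simp

lemma sgn_dualp: "sgn (dualp p z) = cnj (sgn z)"
proof (cases "z = 0")
  case False
  have "sgn (cnj (sgn z)) = cnj (sgn z)"
    using False by (simp add: sgn_eq norm_divide)
  then show ?thesis
    using False by (simp add: dualp_def sgn_mult sgn_of_real)
qed simp

lemma dualp_dualp:
  assumes "(p - 1) * (q - 1) = 1"
  shows "dualp q (dualp p z) = z"
proof (cases "z = 0")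
  case False
  have "dualp q (dualp p z) = sgn z * of_real (cmod z powr ((p - 1) * (q - 1)))"
    unfolding dualp_def [of q] by (simp add: sgn_dualp cmod_dualp powr_powr)
  with assms False show ?thesis by (simp add: sgn_eq)
qed simp

text \<open>Young's inequality for \<open>x\<close> and \<open>y powr (p - 1)\<close>, cleared of
  the conjugate exponent so that \<open>p = 1\<close> is included.\<close>

lemma mult_powr_le:
  fixes x y :: real
  assumes "1 \<le> p" "0 \<le> x" "0 \<le> y"
  shows "p * (x * y powr (p - 1)) \<le> x powr p + (p - 1) * y powr p"
proof (cases "p = 1")
  case True
  then show ?thesis using assms by (cases "y = 0") auto
next
  case False
  then have p: "1 < p" using assms by simp
  define q where "q = p / (p - 1)"
  have q: "1 < q" "1 / p + 1 / q = 1" "(p - 1) * q = p"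
    using p by (auto simp: q_def divide_simps)
  have "x * y powr (p - 1) \<le> x powr p / p + (y powr (p - 1)) powr q / q"
    by (rule Youngs_inequality) (use p q assms in auto)
  also have "\<dots> = x powr p / p + y powr p / q"
    by (simp add: powr_powr q)
  finally have "p * (x * y powr (p - 1)) \<le> p * (x powr p / p + y powr p / q)"
    using p by simp
  also have "\<dots> = x powr p + (p - 1) * y powr p"
    using p by (simp add: q_def field_simps)
  finally show ?thesis .
qed

text \<open>\<open>p * Re (h * dualp p u)\<close> is the derivative of \<open>cmod z powr p\<close>
  at \<open>u\<close> in direction \<open>h\<close>; for \<open>p = 1\<close> and
  \<open>u = 0\<close> the value 0 selects one subgradient. After expansion, Young's inequality
  bounds the cross term. The variational arguments below use this bound or its integral
  \<open>pint_tangent\<close>.\<close>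

lemma powr_convex_tangent:
  assumes "1 \<le> p"
  shows "cmod u powr p + p * Re ((z - u) * dualp p u) \<le> cmod z powr p"
proof -
  have "Re (z * dualp p u) \<le> cmod z * cmod u powr (p - 1)"
    using complex_Re_le_cmod [of "z * dualp p u"] by (simp add: norm_mult cmod_dualp)
  then have "p * Re (z * dualp p u) \<le> p * (cmod z * cmod u powr (p - 1))"
    using assms by simp
  also have "\<dots> \<le> cmod z powr p + (p - 1) * cmod u powr p"
    by (rule mult_powr_le) (use assms in auto)
  finally show ?thesis
    by (simp add: left_diff_distrib mult_dualp algebra_simps)
qed

text \<open>If the pairing vanishes, both cross terms are as large as their moduli allow. As the
  power \<open>p - 1\<close> is strictly increasing, the moduli of \<open>z\<close> and
  \<open>u\<close> agree; equality in Cauchy-Schwarz then gives \<open>z = u\<close>.\<close>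

lemma dualp_strict_mono:
  assumes p: "1 < p" and eq: "Re ((z - u) * (dualp p z - dualp p u)) = 0"
  shows "z = u"
proof -
  let ?a = "cmod z" and ?b = "cmod u"
  have a: "Re (u * dualp p z) \<le> ?b * ?a powr (p - 1)"
    using complex_Re_le_cmod [of "u * dualp p z"] by (simp add: norm_mult cmod_dualp)
  have b: "Re (z * dualp p u) \<le> ?a * ?b powr (p - 1)"
    using complex_Re_le_cmod [of "z * dualp p u"] by (simp add: norm_mult cmod_dualp)
  have pow: "x powr p = x * x powr (p - 1)" if "0 \<le> x" for x :: real
    using that powr_add [of x 1 "p - 1"] by (cases "x = 0") auto
  have "Re ((z - u) * (dualp p z - dualp p u)) =
      ?a powr p + ?b powr p - Re (u * dualp p z) - Re (z * dualp p u)"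
    by (simp add: left_diff_distrib right_diff_distrib mult_dualp)
  then have 1: "?a powr p + ?b powr p = Re (u * dualp p z) + Re (z * dualp p u)"
    using eq by simp
  then have neg: "(?a - ?b) * (?a powr (p - 1) - ?b powr (p - 1)) \<le> 0"
    using a b by (simp add: pow algebra_simps)
  have "?a = ?b"
  proof (rule ccontr)
    assume "?a \<noteq> ?b"
    then consider "?a < ?b" | "?b < ?a" by linarith
    then show False
    proof cases
      case 1
      then have "?a powr (p - 1) < ?b powr (p - 1)" using p by (intro powr_less_mono2) auto
      with 1 have "0 < (?a - ?b) * (?a powr (p - 1) - ?b powr (p - 1))" by (intro mult_neg_neg) auto
      then show False using neg by simp
    next
      case 2
      then have "?b powr (p - 1) < ?a powr (p - 1)" using p by (intro powr_less_mono2) auto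
      with 2 have "0 < (?a - ?b) * (?a powr (p - 1) - ?b powr (p - 1))" by (intro mult_pos_pos) auto
      then show False using neg by simp
    qed
  qed
  show ?thesis
  proof (cases "z = 0")
    case True
    with \<open>?a = ?b\<close> show ?thesis by simp
  next
    case False
    have "Re (u * dualp p z) = ?a powr p"
      using 1 a b \<open>?a = ?b\<close> by (simp add: pow)
    then have "Re (u * cnj (sgn z)) * ?a powr (p - 1) = ?a * ?a powr (p - 1)"
      by (simp add: dualp_def pow algebra_simps)
    then have "Re (u * cnj (sgn z)) = ?a" using False by simp
    moreover have "u * cnj (sgn z) = u * cnj z / of_real ?a"
      by (simp add: sgn_eq)
    ultimately have "Re (u * cnj z) = ?a * ?a"
      using False by (simp add: field_simps)
    moreover have "(cmod (z - u))\<^sup>2 = ?a\<^sup>2 + ?b\<^sup>2 - 2 * Re (u * cnj z)"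
      unfolding cmod_power2 by (simp add: power2_eq_square algebra_simps)
    ultimately have "(cmod (z - u))\<^sup>2 = 0"
      using \<open>?a = ?b\<close> by (simp add: power2_eq_square)
    then show ?thesis by simp
  qed
qed

lemma continuous_dualp:
  assumes "1 < p"
  shows "isCont (dualp p) z"
proof (cases "z = 0")
  case True
  have "((\<lambda>w. cmod w powr (p - 1)) \<longlongrightarrow> 0 powr (p - 1)) (at (0::complex))"
    using assms by (intro tendsto_powr2) (auto intro!: tendsto_eq_intros)
  then have "((\<lambda>w. cmod (dualp p w)) \<longlongrightarrow> 0) (at 0)"
    by (simp add: cmod_dualp)
  then show ?thesis
    unfolding True isCont_def by (simp add: tendsto_norm_zero_iff)
next
  case False
  then show ?thesis
    unfolding dualp_def by (auto intro!: continuous_intros)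
qed

lemma borel_measurable_cnj [measurable]: "cnj \<in> borel_measurable borel"
  by (intro borel_measurable_continuous_onI continuous_intros)

lemma borel_measurable_of_real_complex [measurable]: "complex_of_real \<in> borel_measurable borel"
  by (intro borel_measurable_continuous_onI continuous_intros)

lemma borel_measurable_sgn_complex [measurable]: "(sgn :: complex \<Rightarrow> complex) \<in> borel_measurable borel"
  unfolding sgn_div_norm [abs_def] by measurable

lemma borel_measurable_dualp [measurable]: "dualp p \<in> borel_measurable borel"
  unfolding dualp_def [abs_def] by measurable

text \<open>The crude factor is enough: the bound serves membership in L^p and limits equal to
  0.\<close>

lemma powr_add_le:
  assumes "0 \<le> p"
  shows "cmod (a + b) powr p \<le> 2 powr p * (cmod a powr p + cmod b powr p)"
proof -
  have "cmod (a + b) \<le> 2 * max (cmod a) (cmod b)"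
    using norm_triangle_ineq [of a b] by linarith
  then have "cmod (a + b) powr p \<le> (2 * max (cmod a) (cmod b)) powr p"
    using assms by (intro powr_mono2) auto
  also have "\<dots> = 2 powr p * max (cmod a) (cmod b) powr p"
    by (simp add: powr_mult)
  also have "max (cmod a) (cmod b) powr p \<le> cmod a powr p + cmod b powr p"
    by (auto simp: max_def)
  finally show ?thesis by simp
qed

text \<open>\<open>mult_powr_le\<close> is the convexity bound at the larger of the two points; it
  acts as a mean value theorem that covers bases equal to 0.\<close>

lemma abs_powr_diff_le:
  fixes a b :: real
  assumes r: "1 \<le> r" and "0 \<le> a" "0 \<le> b"
  shows "\<bar>a powr r - b powr r\<bar> \<le> r * max a b powr (r - 1) * \<bar>a - b\<bar>"
proof -
  have *: "x powr r - y powr r \<le> r * x powr (r - 1) * (x - y)" if "0 \<le> y" "y \<le> x" for x y :: real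
  proof -
    have "x powr r = x * x powr (r - 1)"
      using that powr_add [of x 1 "r - 1"] by (cases "x = 0") auto
    then show ?thesis
      using mult_powr_le [of r y x] r that by (simp add: algebra_simps)
  qed
  have mono: "y powr r \<le> x powr r" if "0 \<le> y" "y \<le> x" for x y :: real
    using that r by (intro powr_mono2) auto
  show ?thesis
    using *[of b a] *[of a b] mono [of b a] mono [of a b] assms
    by (cases "a \<le> b") (auto simp: max_def abs_if not_le)
qed

text \<open>A local Lipschitz bound, needed to dominate the difference quotients of
  \<open>dualp p\<close> along functions.\<close>

lemma cmod_dualp_diff_le:
  assumes p: "2 < p"
  shows "cmod (dualp p (z + h) - dualp p z) \<le> p * (cmod h * (cmod z + cmod h) powr (p - 2))"
proof -
  let ?a = "cmod (z + h)" and ?b = "cmod z" and ?m = "(cmod z + cmod h) powr (p - 2)"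
  have ab: "\<bar>?a - ?b\<bar> \<le> cmod h" "?a \<le> ?b + cmod h"
    using norm_triangle_ineq [of z h] norm_triangle_ineq3 [of "z + h" z] by auto
  have m: "?a powr (p - 2) \<le> ?m" "max ?a ?b powr (p - 2) \<le> ?m"
    using ab p by (auto intro!: powr_mono2 simp: le_max_iff_disj)
  have pow: "x powr (p - 1) = x * x powr (p - 2)" if "0 \<le> x" for x :: real
    using that powr_add [of x 1 "p - 2"] by (cases "x = 0") auto
  \<comment> \<open>For \<open>p < 3\<close> the power \<open>p - 2\<close> is not Lipschitz near 0;
    the factor \<open>?b\<close> raises the exponent to \<open>p - 1\<close>, which exceeds
    1.\<close>
  have "?b * \<bar>?a powr (p - 2) - ?b powr (p - 2)\<bar> \<le> \<bar>?a powr (p - 1) - ?b powr (p - 1)\<bar>"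
  proof (cases "?b \<le> ?a")
    case True
    then have "?b * ?a powr (p - 2) \<le> ?a * ?a powr (p - 2)" by (intro mult_right_mono) auto
    moreover have "?b powr (p - 2) \<le> ?a powr (p - 2)" using True p by (intro powr_mono2) auto
    ultimately show ?thesis using True by (simp add: pow algebra_simps)
  next
    case False
    then have "?a * ?a powr (p - 2) \<le> ?b * ?a powr (p - 2)" by (intro mult_right_mono) auto
    moreover have "?a powr (p - 2) \<le> ?b powr (p - 2)" using False p by (intro powr_mono2) auto
    ultimately show ?thesis using False by (simp add: pow algebra_simps abs_if)
  qed
  also have "\<dots> \<le> (p - 1) * max ?a ?b powr (p - 1 - 1) * \<bar>?a - ?b\<bar>"
    by (rule abs_powr_diff_le) (use p in auto)
  also have "\<dots> \<le> (p - 1) * ?m * cmod h"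
    using m ab p by (intro mult_mono) auto
  finally have 1: "?b * \<bar>?a powr (p - 2) - ?b powr (p - 2)\<bar> \<le> (p - 1) * ?m * cmod h" .
  have "dualp p (z + h) - dualp p z = cnj h * of_real (?a powr (p - 2)) +
      cnj z * of_real (?a powr (p - 2) - ?b powr (p - 2))"
    using p by (simp add: dualp_eq_cnj algebra_simps)
  then have "cmod (dualp p (z + h) - dualp p z) \<le>
      cmod h * ?a powr (p - 2) + ?b * \<bar>?a powr (p - 2) - ?b powr (p - 2)\<bar>"
    using norm_triangle_ineq [of "cnj h * of_real (?a powr (p - 2))"
      "cnj z * of_real (?a powr (p - 2) - ?b powr (p - 2))"]
    by (simp add: norm_mult del: of_real_diff)
  also have "\<dots> \<le> cmod h * ?m + (p - 1) * ?m * cmod h"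
    using 1 m by (intro add_mono mult_left_mono) auto
  finally show ?thesis by (simp add: algebra_simps)
qed

text \<open>\<open>D z w\<close> is only real-linear in \<open>w\<close>, as its second term
  differentiates the modulus. The exponent \<open>p - 4\<close> may be negative, but the factor
  \<open>cnj z\<close> removes that term at \<open>z = 0\<close>; elsewhere the modulus is a power
  of a quadratic polynomial in \<open>e\<close> that is positive at 0.\<close>

lemma dualp_diff_quotient:
  assumes p: "2 < p"
  defines "D \<equiv> \<lambda>z w. cnj w * of_real (cmod z powr (p - 2)) +
     cnj z * of_real ((p - 2) * cmod z powr (p - 4) * Re (cnj z * w))"
  shows "((\<lambda>e. (dualp p (z + of_real e * w) - dualp p z) / of_real e) \<longlongrightarrow> D z w) (at_right 0)"
proof -
  have ev0: "eventually (\<lambda>e::real. e \<noteq> 0) (at_right 0)"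
    by (simp add: eventually_at_filter)
  have t1: "((\<lambda>e. cmod (z + of_real e * w) powr (p - 2)) \<longlongrightarrow> cmod z powr (p - 2)) (at_right 0)"
    by (rule tendsto_eq_intros tendsto_powr2 | (use p in simp))+
  have t2: "((\<lambda>e. cnj z * of_real ((cmod (z + of_real e * w) powr (p - 2) - cmod z powr (p - 2)) / e)) \<longlongrightarrow>
      cnj z * of_real ((p - 2) * cmod z powr (p - 4) * Re (cnj z * w))) (at_right 0)"
  proof (cases "z = 0")
    case False
    define r where "r = Re (cnj z * w)"
    define q where "q = (\<lambda>e. (cmod z)\<^sup>2 + 2 * e * r + e\<^sup>2 * (cmod w)\<^sup>2)"
    have sq: "(x\<^sup>2) powr (s / 2) = x powr s" if "0 \<le> x" for x s :: real
    proof -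
      have "x powr 2 = x\<^sup>2" "2 * (s / 2) = s"
        using that by simp_all
      then show ?thesis by (metis powr_powr)
    qed
    have q: "cmod (z + of_real e * w) powr (p - 2) = q e powr ((p - 2) / 2)" for e
    proof -
      have "q e = (cmod (z + of_real e * w))\<^sup>2"
        unfolding q_def r_def by (simp add: cmod_power2) (simp add: power2_eq_square algebra_simps)
      then show ?thesis by (simp add: sq)
    qed
    have q0: "q 0 = (cmod z)\<^sup>2" by (simp add: q_def)
    have "(q has_real_derivative 2 * r) (at 0)"
      unfolding q_def by (auto intro!: derivative_eq_intros)
    then have "((\<lambda>e. q e powr ((p - 2) / 2)) has_real_derivative
        (p - 2) / 2 * q 0 powr ((p - 2) / 2 - 1) * (2 * r)) (at 0)"
      using False q0 by (auto intro!: DERIV_fun_powr [THEN DERIV_cong])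
    moreover have "q 0 powr ((p - 2) / 2 - 1) = cmod z powr (p - 4)"
      using sq [of "cmod z" "p - 4"] by (simp add: q0 diff_divide_distrib)
    ultimately have "((\<lambda>e. q e powr ((p - 2) / 2)) has_real_derivative
        (p - 2) * cmod z powr (p - 4) * r) (at 0)"
      by (simp add: mult.assoc)
    then have "((\<lambda>e. (cmod (z + of_real e * w) powr (p - 2) - cmod z powr (p - 2)) / e) \<longlongrightarrow>
        (p - 2) * cmod z powr (p - 4) * r) (at 0)"
      by (simp add: DERIV_def flip: q)
    then show ?thesis
      unfolding r_def [symmetric]
      by (intro tendsto_mult tendsto_const tendsto_of_real)
        (rule filterlim_mono [OF _ order_refl at_le], auto)
  qed simp
  have "((\<lambda>e. cnj w * of_real (cmod (z + of_real e * w) powr (p - 2)) +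
     cnj z * of_real ((cmod (z + of_real e * w) powr (p - 2) - cmod z powr (p - 2)) / e)) \<longlongrightarrow> D z w) (at_right 0)"
    unfolding D_def by (intro tendsto_add tendsto_mult tendsto_const tendsto_of_real t1 t2 [unfolded of_real_mult] t2)
  then show ?thesis
    by (rule Lim_transform_eventually)
      (use ev0 in eventually_elim, use p in \<open>simp add: dualp_eq_cnj field_simps\<close>)
qed

section \<open>Functions in \<open>L\<^sup>p\<close>\<close>

text \<open>The \<open>p\<close>-th power of the norm, to which the pointwise tangent bound
  integrates directly; roots appear only in the comparison with \<open>Lp_norm\<close>.\<close>

definition pint :: "real \<Rightarrow> 'x measure \<Rightarrow> ('x \<Rightarrow> complex) \<Rightarrow> real" where
  "pint p M f = (\<integral>x. cmod (f x) powr p \<partial>M)"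

lemma Lp_fun_measurable [measurable_dest]: "f \<in> Lp_fun p M \<Longrightarrow> f \<in> borel_measurable M"
  by (simp add: Lp_fun_def)

lemma Lp_fun_integrable: "f \<in> Lp_fun p M \<Longrightarrow> integrable M (\<lambda>x. cmod (f x) powr p)"
  by (simp add: Lp_fun_def)

lemma Lp_funI:
  assumes [measurable]: "f \<in> borel_measurable M" and "integrable M h" "AE x in M. cmod (f x) powr p \<le> h x"
  shows "f \<in> Lp_fun p M"
proof -
  have "integrable M (\<lambda>x. cmod (f x) powr p)"
    by (rule Bochner_Integration.integrable_bound [OF assms(2)])
      (use assms(3) in \<open>auto elim!: eventually_mono\<close>)
  then show ?thesis by (simp add: Lp_fun_def)
qed

lemma Lp_fun_bound:
  assumes "f \<in> borel_measurable M" "g \<in> Lp_fun p M" "0 \<le> p" "AE x in M. cmod (f x) \<le> cmod (g x)"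
  shows "f \<in> Lp_fun p M"
  by (rule Lp_funI [OF assms(1) Lp_fun_integrable [OF assms(2)]])
    (use assms(3,4) in \<open>auto elim!: eventually_mono intro!: powr_mono2\<close>)

lemma Lp_fun_add:
  assumes "f \<in> Lp_fun p M" "g \<in> Lp_fun p M" "0 \<le> p"
  shows "(\<lambda>x. f x + g x) \<in> Lp_fun p M"
proof (rule Lp_funI)
  show "integrable M (\<lambda>x. 2 powr p * (cmod (f x) powr p + cmod (g x) powr p))"
    using assms by (intro integrable_mult_right Bochner_Integration.integrable_add Lp_fun_integrable)
qed (use assms powr_add_le in auto)

lemma Lp_fun_scale:
  assumes "f \<in> Lp_fun p M" "0 \<le> p"
  shows "(\<lambda>x. c * f x) \<in> Lp_fun p M"
  by (rule Lp_funI [where h = "\<lambda>x. cmod c powr p * cmod (f x) powr p"])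
    (use assms Lp_fun_integrable in \<open>auto simp: norm_mult powr_mult\<close>)

lemma Lp_fun_diff:
  assumes "f \<in> Lp_fun p M" "g \<in> Lp_fun p M" "0 \<le> p"
  shows "(\<lambda>x. f x - g x) \<in> Lp_fun p M"
  using Lp_fun_add [OF assms(1) Lp_fun_scale [OF assms(2,3), of "-1"] assms(3)] by simp

lemma Lp_fun_abs_add:
  assumes "f \<in> Lp_fun p M" "g \<in> Lp_fun p M" "0 \<le> p"
  shows "(\<lambda>x. complex_of_real (cmod (f x) + cmod (g x))) \<in> Lp_fun p M"
proof -
  have "(\<lambda>x. complex_of_real (cmod (u x))) \<in> Lp_fun p M" if u: "u \<in> Lp_fun p M" for u
    by (rule Lp_fun_bound [OF _ u]) (use u assms in auto)
  from Lp_fun_add [OF this [OF assms(1)] this [OF assms(2)] assms(3)]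
  show ?thesis by simp
qed

lemma pint_nonneg: "0 \<le> pint p M f"
  unfolding pint_def by (rule integral_nonneg_AE) auto

lemma pint_cong_AE:
  assumes [measurable]: "f \<in> borel_measurable M" "g \<in> borel_measurable M" and "AE x in M. f x = g x"
  shows "pint p M f = pint p M g"
  unfolding pint_def by (rule integral_cong_AE) (use assms in \<open>auto elim!: eventually_mono\<close>)

lemma pint_mono:
  assumes "f \<in> Lp_fun p M" "g \<in> Lp_fun p M" "0 \<le> p" "AE x in M. cmod (f x) \<le> cmod (g x)"
  shows "pint p M f \<le> pint p M g"
  unfolding pint_def
  by (rule integral_mono_AE) (use assms Lp_fun_integrable in \<open>auto elim!: eventually_mono intro!: powr_mono2\<close>)

lemma pint_scale: "pint p M (\<lambda>x. c * f x) = cmod c powr p * pint p M f"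
  by (simp add: pint_def norm_mult powr_mult)

lemma pint_minus_commute: "pint p M (\<lambda>x. f x - g x) = pint p M (\<lambda>x. g x - f x)"
  by (simp add: pint_def norm_minus_commute)

lemma pint_add_le:
  assumes "f \<in> Lp_fun p M" "g \<in> Lp_fun p M" "0 \<le> p"
  shows "pint p M (\<lambda>x. f x + g x) \<le> 2 powr p * (pint p M f + pint p M g)"
proof -
  have "pint p M (\<lambda>x. f x + g x) \<le> (\<integral>x. 2 powr p * (cmod (f x) powr p + cmod (g x) powr p) \<partial>M)"
    unfolding pint_def
    by (rule integral_mono_AE)
      (use assms powr_add_le in \<open>auto intro!: Lp_fun_integrable Lp_fun_add\<close>)
  then show ?thesis
    using assms by (simp add: pint_def Lp_fun_integrable)
qed

lemma pint_eq_0D: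
  assumes "f \<in> Lp_fun p M" "pint p M f = 0"
  shows "AE x in M. f x = 0"
proof -
  have "AE x in M. cmod (f x) powr p = 0"
    using integral_nonneg_eq_0_iff_AE [OF Lp_fun_integrable [OF assms(1)]] assms(2)
    by (auto simp: pint_def)
  then show ?thesis by (auto elim!: eventually_mono)
qed

lemma Lp_dominated:
  assumes p: "0 < p" and f: "\<And>n. f n \<in> Lp_fun p M" and [measurable]: "F \<in> borel_measurable M"
    and h: "h \<in> Lp_fun p M"
    and lim: "AE x in M. (\<lambda>n. f n x) \<longlonglongrightarrow> F x"
    and bound: "\<And>n. AE x in M. cmod (f n x) \<le> cmod (h x)"
  shows Lp_fun_dominated: "F \<in> Lp_fun p M"
    and pint_dominated: "(\<lambda>n. pint p M (\<lambda>x. f n x - F x)) \<longlonglongrightarrow> 0"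
proof -
  have [measurable]: "f n \<in> borel_measurable M" for n
    using f by (simp add: Lp_fun_def)
  have bound': "AE x in M. \<forall>n. cmod (f n x) \<le> cmod (h x)"
    unfolding AE_all_countable using bound by blast
  have F: "AE x in M. cmod (F x) \<le> cmod (h x)"
    using bound' lim
  proof eventually_elim
    case (elim x)
    show ?case by (rule Lim_bounded [OF tendsto_norm [OF elim(2)], of 0]) (use elim(1) in simp)
  qed
  then show FL: "F \<in> Lp_fun p M"
    using p by (intro Lp_fun_bound [OF _ h]) auto
  have "(\<lambda>n. \<integral>x. cmod (f n x - F x) powr p \<partial>M) \<longlonglongrightarrow> (\<integral>x. 0 \<partial>M)"
  proof (rule integral_dominated_convergence)
    show "integrable M (\<lambda>x. 2 powr p * cmod (h x) powr p)"
      using Lp_fun_integrable [OF h] by simp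
    show "AE x in M. (\<lambda>n. cmod (f n x - F x) powr p) \<longlonglongrightarrow> 0"
      using lim
    proof eventually_elim
      case (elim x)
      then have "(\<lambda>n. cmod (f n x - F x)) \<longlonglongrightarrow> 0"
        by (simp add: tendsto_norm_zero_iff LIM_zero_iff)
      then have "(\<lambda>n. cmod (f n x - F x) powr p) \<longlonglongrightarrow> 0 powr p"
        using p by (intro tendsto_powr2) auto
      then show ?case by simp
    qed
    show "AE x in M. norm (cmod (f n x - F x) powr p) \<le> 2 powr p * cmod (h x) powr p" for n
      using bound [of n] F
    proof eventually_elim
      case (elim x)
      then have "cmod (f n x - F x) \<le> 2 * cmod (h x)"
        using norm_triangle_ineq4 [of "f n x" "F x"] by simp
      then have "cmod (f n x - F x) powr p \<le> (2 * cmod (h x)) powr p"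
        using p by (intro powr_mono2) auto
      then show ?case by (simp add: powr_mult)
    qed
  qed auto
  then show "(\<lambda>n. pint p M (\<lambda>x. f n x - F x)) \<longlonglongrightarrow> 0"
    by (simp add: pint_def)
qed

text \<open>Young's inequality supplies an integrable majorant, also for \<open>p = 1\<close>, where
  \<open>dualp p\<close> is merely bounded.\<close>

lemma integrable_mult_dualp:
  assumes p: "1 \<le> p" and "f \<in> Lp_fun p M" "g \<in> Lp_fun p M"
  shows "integrable M (\<lambda>x. f x * dualp p (g x))"
proof (rule Bochner_Integration.integrable_bound)
  show "integrable M (\<lambda>x. cmod (f x) powr p + (p - 1) * cmod (g x) powr p)"
    using assms by (auto intro!: Lp_fun_integrable)
  show "AE x in M. norm (f x * dualp p (g x)) \<le> norm (cmod (f x) powr p + (p - 1) * cmod (g x) powr p)"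
  proof (rule AE_I2)
    fix x
    have "cmod (f x) * cmod (g x) powr (p - 1) \<le> p * (cmod (f x) * cmod (g x) powr (p - 1))"
      using p mult_right_mono [of 1 p "cmod (f x) * cmod (g x) powr (p - 1)"] by simp
    also have "\<dots> \<le> cmod (f x) powr p + (p - 1) * cmod (g x) powr p"
      by (rule mult_powr_le) (use p in auto)
    finally show "norm (f x * dualp p (g x)) \<le> norm (cmod (f x) powr p + (p - 1) * cmod (g x) powr p)"
      by (simp add: norm_mult cmod_dualp)
  qed
qed (use assms in measurable)

text \<open>Conjugacy is written as \<open>(p - 1) * (q - 1) = 1\<close> because this is symmetric
  and says at once that \<open>dualp q\<close> inverts \<open>dualp p\<close>.\<close>

lemma conjugate_exponentD:
  fixes p q :: real
  assumes "1 < p" "(p - 1) * (q - 1) = 1"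
  shows "1 < q" "(p - 1) * q = p"
proof -
  show "1 < q" using assms by (metis diff_gt_0_iff_gt zero_less_mult_pos zero_less_one)
  show "(p - 1) * q = p" using assms(2) by (simp add: algebra_simps)
qed

lemma dualp_Lp_fun:
  assumes "1 < p" "(p - 1) * (q - 1) = 1" "f \<in> Lp_fun p M"
  shows "(\<lambda>x. dualp p (f x)) \<in> Lp_fun q M"
  by (rule Lp_funI [OF _ Lp_fun_integrable [OF assms(3)]])
    (use assms(3) conjugate_exponentD [OF assms(1,2)] in \<open>auto simp: cmod_dualp powr_powr\<close>)

lemma integral_mult_dualp_self:
  "(\<integral>x. f x * dualp p (f x) \<partial>M) = of_real (pint p M f)"
  unfolding pint_def mult_dualp by simp

lemma pint_tangent:
  assumes p: "1 \<le> p" and f: "f \<in> Lp_fun p M" and g: "g \<in> Lp_fun p M"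
  shows "pint p M f + p * Re (\<integral>x. (g x - f x) * dualp p (f x) \<partial>M) \<le> pint p M g"
proof -
  have i: "integrable M (\<lambda>x. (g x - f x) * dualp p (f x))"
    using p f g by (intro integrable_mult_dualp Lp_fun_diff) auto
  have "pint p M f + p * Re (\<integral>x. (g x - f x) * dualp p (f x) \<partial>M) =
      (\<integral>x. cmod (f x) powr p + p * Re ((g x - f x) * dualp p (f x)) \<partial>M)"
    using f unfolding pint_def integral_Re [OF i, symmetric]
    by (subst Bochner_Integration.integral_add) (auto intro!: Lp_fun_integrable integrable_mult_right integrable_Re i simp del: times_complex.sel)
  also have "\<dots> \<le> pint p M g"
    unfolding pint_def
    by (rule integral_mono_AE)
      (use p f g i powr_convex_tangent in \<open>auto intro!: Bochner_Integration.integrable_add integrable_mult_right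
          integrable_Re Lp_fun_integrable simp del: times_complex.sel\<close>)
  finally show ?thesis .
qed

text \<open>The functions \<open>\<bar>f\<bar> powr (1 - \<theta> ^ n) * \<bar>g\<bar> powr \<theta> ^ n * sgn g\<close> with \<open>\<theta> = q - 1 < 1\<close>
  stay in \<open>E\<close>, because differentiating \<open>dualp p\<close> at \<open>f\<close> in the directions \<open>g\<close> and \<open>\<i> g\<close>
  produces the function \<open>\<bar>f\<bar> powr (p - 2) * cnj g\<close> of \<open>N\<close>.\<close>

lemma abs_mult_sgn_closed:
  fixes E N :: "('x \<Rightarrow> complex) set"
  assumes p: "2 < p" and pq: "(p - 1) * (q - 1) = 1"
    and E: "E \<subseteq> Lp_fun p M" 
    and addE: "\<And>f g. f \<in> E \<Longrightarrow> g \<in> E \<Longrightarrow> (\<lambda>x. f x + g x) \<in> E"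
    and scaleE: "\<And>c f. f \<in> E \<Longrightarrow> (\<lambda>x. c * f x) \<in> E"
    and domE: "\<And>f F h. (\<And>n. f n \<in> E) \<Longrightarrow> F \<in> borel_measurable M \<Longrightarrow> h \<in> Lp_fun p M \<Longrightarrow>
       (\<And>x. (\<lambda>n. f n x) \<longlonglongrightarrow> F x) \<Longrightarrow> (\<And>n x. cmod (f n x) \<le> cmod (h x)) \<Longrightarrow> F \<in> E"
    and addN: "\<And>f g. f \<in> N \<Longrightarrow> g \<in> N \<Longrightarrow> (\<lambda>x. f x + g x) \<in> N"
    and scaleN: "\<And>c f. f \<in> N \<Longrightarrow> (\<lambda>x. c * f x) \<in> N"
    and domN: "\<And>f F h. (\<And>n. f n \<in> N) \<Longrightarrow> F \<in> borel_measurable M \<Longrightarrow> h \<in> Lp_fun q M \<Longrightarrow>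
       (\<And>x. (\<lambda>n. f n x) \<longlonglongrightarrow> F x) \<Longrightarrow> (\<And>n x. cmod (f n x) \<le> cmod (h x)) \<Longrightarrow> F \<in> N"
    and EN: "\<And>f. f \<in> E \<Longrightarrow> (\<lambda>x. dualp p (f x)) \<in> N"
    and NE: "\<And>f. f \<in> N \<Longrightarrow> (\<lambda>x. dualp q (f x)) \<in> E"
    and f: "f \<in> E" and g: "g \<in> E"
  shows "(\<lambda>x. of_real (cmod (f x)) * sgn (g x)) \<in> E"
proof -
  note q = conjugate_exponentD [OF _ pq]
  \<comment> \<open>\<open>dualp q\<close> raises moduli to the power \<theta>, the reciprocal of
    \<open>p - 1\<close>. The identity \<open>(p - 2) * \<theta> = 1 - \<theta>\<close> turns
    \<open>cmod f powr (p - 2)\<close> into the complementary weight of a geometric mean.\<close>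
  define \<theta> where "\<theta> = q - 1"
  have \<theta>: "0 < \<theta>" "\<theta> < 1" "(p - 2) * \<theta> = 1 - \<theta>"
  proof -
    show "0 < \<theta>" using q p by (simp add: \<theta>_def)
    have "\<theta> = 1 / (p - 1)" using pq p by (simp add: \<theta>_def field_simps)
    then show "\<theta> < 1" using p by simp
    show "(p - 2) * \<theta> = 1 - \<theta>" using pq by (simp add: \<theta>_def algebra_simps)
  qed
  have [measurable]: "u \<in> borel_measurable M" if "u \<in> E" for u
    using that E by (auto simp: Lp_fun_def)
  have [measurable]: "f \<in> borel_measurable M" "g \<in> borel_measurable M" using f g by measurable
  define D where "D = (\<lambda>z w. cnj w * of_real (cmod z powr (p - 2)) +
     cnj z * of_real ((p - 2) * cmod z powr (p - 4) * Re (cnj z * w)))"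
  \<comment> \<open>\<open>N\<close> is linear, contains \<open>dualp p\<close> of
    \<open>f + e w\<close>, and is closed under dominated limits, so it contains the limit of the
    difference quotients along \<open>e = 1 / (n + 1)\<close>.\<close>
  have D: "(\<lambda>x. D (f x) (w x)) \<in> N" if w: "w \<in> E" for w
  proof (rule domN)
    let ?e = "\<lambda>n. inverse (real (Suc n))"
    have e: "filterlim ?e (at_right 0) sequentially"
      using LIMSEQ_inverse_real_of_nat by (rule tendsto_imp_filterlim_at_right) auto
    show "(\<lambda>x. of_real (inverse (?e n)) * (dualp p (f x + of_real (?e n) * w x) + (-1) * dualp p (f x))) \<in> N" for n
      by (intro scaleN addN EN addE scaleE f w)
    have [measurable]: "w \<in> borel_measurable M" using w by measurable
    show "(\<lambda>x. D (f x) (w x)) \<in> borel_measurable M"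
      unfolding D_def by measurable
    have L: "(\<lambda>x. complex_of_real (cmod (f x) + cmod (w x))) \<in> Lp_fun p M"
      using f w E p by (intro Lp_fun_abs_add) auto
    show "(\<lambda>x. of_real p * dualp p (of_real (cmod (f x) + cmod (w x)))) \<in> Lp_fun q M"
      using p pq L q by (intro Lp_fun_scale dualp_Lp_fun) auto
    show "(\<lambda>n. of_real (inverse (?e n)) * (dualp p (f x + of_real (?e n) * w x) + (-1) * dualp p (f x)))
        \<longlonglongrightarrow> D (f x) (w x)" for x
      using filterlim_compose [OF dualp_diff_quotient [OF p, of "f x" "w x"] e]
      unfolding D_def by (simp add: divide_inverse mult.commute)
    show "cmod (of_real (inverse (?e n)) * (dualp p (f x + of_real (?e n) * w x) + (-1) * dualp p (f x)))
       \<le> cmod (of_real p * dualp p (of_real (cmod (f x) + cmod (w x))))" for n x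
    proof -
      define e where "e = ?e n"
      have e: "0 < e" "e \<le> 1" by (auto simp: e_def field_simps)
      let ?m = "cmod (f x) + cmod (w x)"
      have le: "cmod (f x) + e * cmod (w x) \<le> ?m" using e by (simp add: mult_left_le_one_le)
      have pow: "?m * ?m powr (p - 2) = ?m powr (p - 1)"
        using powr_add [of ?m 1 "p - 2"] by (cases "?m = 0") auto
      have "cmod (dualp p (f x + of_real e * w x) - dualp p (f x)) \<le>
          p * (e * cmod (w x) * (cmod (f x) + e * cmod (w x)) powr (p - 2))"
        using cmod_dualp_diff_le [OF p, of "f x" "of_real e * w x"] e by (simp add: norm_mult)
      also have "\<dots> \<le> p * (e * ?m * ?m powr (p - 2))"
        using p e le by (intro mult_left_mono mult_mono powr_mono2) auto
      also have "\<dots> = e * (p * ?m powr (p - 1))"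
        by (simp add: pow [symmetric])
      finally have "inverse e * cmod (dualp p (f x + of_real e * w x) - dualp p (f x)) \<le> p * ?m powr (p - 1)"
        using e by (simp add: field_simps)
      then show ?thesis
        using p e unfolding e_def [symmetric] norm_mult cmod_dualp norm_of_real norm_inverse
        by (simp del: of_real_add)
    qed
  qed
  have step: "(\<lambda>x. sgn (w x) * of_real (cmod (w x) powr \<theta> * cmod (f x) powr (1 - \<theta>))) \<in> E" if w: "w \<in> E" for w
  proof -
    \<comment> \<open>Adding \<i> times the derivative in direction \<open>\<i> w\<close> isolates
      the part antilinear in \<open>w\<close>. It occurs with coefficient 2 + (p - 2) = p, whence
      the factor \<open>1 / p\<close>.\<close>
    have "(\<lambda>x. of_real (1 / p) * (D (f x) (w x) + \<i> * D (f x) (\<i> * w x))) \<in> N"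
      by (rule scaleN [OF addN [OF D [OF w] scaleN [OF D [OF scaleE [OF w]]]]])
    moreover have "of_real (1 / p) * (D z u + \<i> * D z (\<i> * u)) = cnj u * of_real (cmod z powr (p - 2))" for z u
    proof (cases "z = 0")
      case False
      define b where "b = cmod z powr (p - 4)"
      have b: "cmod z powr (p - 2) = b * (cmod z)\<^sup>2"
        using False powr_add [of "cmod z" "p - 4" 2] by (simp add: b_def)
      have "D z u + \<i> * D z (\<i> * u) = of_real p * (cnj u * of_real (b * (cmod z)\<^sup>2))"
        unfolding D_def b_def [symmetric] b cmod_power2
        by (simp add: complex_eq_iff power2_eq_square algebra_simps)
      then show ?thesis using p by (simp add: b)
    qed (use p in \<open>simp add: D_def\<close>)
    ultimately have "(\<lambda>x. cnj (w x) * of_real (cmod (f x) powr (p - 2))) \<in> N"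
      by simp
    from NE [OF this]
    have "(\<lambda>x. dualp q (cnj (w x) * of_real (cmod (f x) powr (p - 2)))) \<in> E" .
    moreover have "dualp q (cnj u * of_real (cmod z powr (p - 2))) =
        sgn u * of_real (cmod u powr \<theta> * cmod z powr (1 - \<theta>))" for u z
    proof -
      have "cnj (sgn (cnj u)) = sgn u" by (simp add: sgn_eq)
      then show ?thesis
        using \<theta>(3) by (cases "z = 0") (simp_all add: dualp_def sgn_mult sgn_of_real norm_mult powr_mult powr_powr \<theta>_def)
    qed
    ultimately show ?thesis by simp
  qed
  define S where "S = (\<lambda>n x. sgn (g x) * of_real (cmod (g x) powr (\<theta> ^ n) * cmod (f x) powr (1 - \<theta> ^ n)))"
  have S_at: "S (Suc (Suc n)) x = sgn (g x) * of_real (cmod (g x) powr (\<theta> ^ Suc (Suc n)) *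
      cmod (f x) powr (1 - \<theta> ^ Suc (Suc n)))" for n x
    by (simp only: S_def)
  \<comment> \<open>The induction starts at index 1: \<open>0 powr 0 = 0\<close> makes
    \<open>S 0\<close> vanish on the zeros of \<open>f\<close>, so it need not be \<open>g\<close>.
    Each step multiplies the exponent of \<open>cmod (g x)\<close> by \<theta>.\<close>
  have S: "S (Suc n) \<in> E" for n
  proof (induction n)
    case 0
    show ?case using step [OF g] by (simp add: S_def)
  next
    case (Suc n)
    have "sgn (S (Suc n) x) * of_real (cmod (S (Suc n) x) powr \<theta> * cmod (f x) powr (1 - \<theta>)) = S (Suc (Suc n)) x" for x
    proof (cases "f x = 0 \<or> g x = 0")
      case True
      then show ?thesis using \<theta> by (auto simp: S_def)
    next
      case False
      let ?t = "\<theta> ^ Suc n" and ?a = "cmod (f x)"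
      have t: "\<theta> ^ Suc (Suc n) = ?t * \<theta>" "(1 - ?t) * \<theta> + (1 - \<theta>) = 1 - ?t * \<theta>"
        by (simp_all add: algebra_simps)
      have "?a powr ((1 - ?t) * \<theta>) * ?a powr (1 - \<theta>) = ?a powr (1 - ?t * \<theta>)"
        unfolding powr_add [symmetric] t ..
      moreover have "sgn (S (Suc n) x) = sgn (g x)" "cmod (S (Suc n) x) = cmod (g x) powr ?t * ?a powr (1 - ?t)"
        using False by (simp_all add: S_def sgn_mult sgn_of_real norm_mult norm_sgn del: power_Suc)
      ultimately show ?thesis
        unfolding S_at t(1)
        by (simp add: powr_mult powr_powr mult.assoc del: power_Suc)
    qed
    with step [OF Suc] show ?case by (simp only:)
  qed
  show ?thesis
  proof (rule domE [OF S])
    show "(\<lambda>x. complex_of_real (cmod (f x)) * sgn (g x)) \<in> borel_measurable M"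
      by measurable
    show "(\<lambda>x. complex_of_real (cmod (f x) + cmod (g x))) \<in> Lp_fun p M"
      using f g E p by (intro Lp_fun_abs_add) auto
    have \<theta>n: "0 < \<theta> ^ Suc n" "\<theta> ^ Suc n < 1" for n
      using \<theta> by (auto simp: power_less_one_iff simp del: power_Suc)
    show "cmod (S (Suc n) x) \<le> cmod (complex_of_real (cmod (f x) + cmod (g x)))" for n x
    proof -
      let ?m = "cmod (f x) + cmod (g x)" and ?t = "\<theta> ^ Suc n"
      have "cmod (S (Suc n) x) \<le> cmod (g x) powr ?t * cmod (f x) powr (1 - ?t)"
        by (cases "g x = 0") (simp_all add: S_def norm_mult norm_sgn)
      also have "\<dots> \<le> ?m powr ?t * ?m powr (1 - ?t)"
        using \<theta>n [of n] by (intro mult_mono powr_mono2) auto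
      also have "\<dots> = ?m powr (?t + (1 - ?t))"
        by (rule powr_add [symmetric])
      also have "\<dots> = ?m"
        by simp
      finally show ?thesis by (simp flip: of_real_add)
    qed
    show "(\<lambda>n. S (Suc n) x) \<longlonglongrightarrow> complex_of_real (cmod (f x)) * sgn (g x)" for x
    proof (cases "f x = 0 \<or> g x = 0")
      case True
      then show ?thesis
        by (auto simp: S_def simp del: power_Suc)
    next
      case False
      have t: "(\<lambda>n. \<theta> ^ Suc n) \<longlonglongrightarrow> 0"
        using \<theta> by (intro LIMSEQ_Suc LIMSEQ_realpow_zero) auto
      have "(\<lambda>n. S (Suc n) x) \<longlonglongrightarrow> sgn (g x) * of_real (cmod (g x) powr 0 * cmod (f x) powr (1 - 0))"
        unfolding S_def using False
        by (intro tendsto_mult tendsto_const tendsto_of_real tendsto_powr tendsto_diff t) auto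
      then show ?thesis using False by (simp add: mult.commute)
    qed
  qed
qed

section \<open>Ranges of contractive projections\<close>

text \<open>\<open>P\<close> acts on functions rather than classes, so its laws hold almost
  everywhere. The intended instance is \<open>T 1\<close> for a representation
  \<open>T\<close>.\<close>

locale contractive_projection =
  fixes p :: real and M :: "'x measure" and P :: "('x \<Rightarrow> complex) \<Rightarrow> 'x \<Rightarrow> complex"
  assumes p1: "1 \<le> p"
    and P_Lp: "\<And>f. f \<in> Lp_fun p M \<Longrightarrow> P f \<in> Lp_fun p M"
    and P_add: "\<And>f g. f \<in> Lp_fun p M \<Longrightarrow> g \<in> Lp_fun p M \<Longrightarrow>
      AE x in M. P (\<lambda>x. f x + g x) x = P f x + P g x"
    and P_scale: "\<And>c f. f \<in> Lp_fun p M \<Longrightarrow> AE x in M. P (\<lambda>x. c * f x) x = c * P f x"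
    and P_idem: "\<And>f. f \<in> Lp_fun p M \<Longrightarrow> AE x in M. P (P f) x = P f x"
    and P_contr: "\<And>f. f \<in> Lp_fun p M \<Longrightarrow> pint p M (P f) \<le> pint p M f"
begin

lemma p0: "0 \<le> p" "0 < p"
  using p1 by auto

lemma P_diff:
  assumes "f \<in> Lp_fun p M" "g \<in> Lp_fun p M"
  shows "AE x in M. P (\<lambda>x. f x - g x) x = P f x - P g x"
  using P_add [OF assms(1) Lp_fun_scale [OF assms(2) p0(1), of "-1"]] P_scale [OF assms(2), of "-1"]
  by eventually_elim simp

section \<open>The range of the projection and its closure properties\<close>

definition rng :: "('x \<Rightarrow> complex) set" where
  "rng = {f \<in> Lp_fun p M. AE x in M. P f x = f x}"

lemma rng_Lp: "f \<in> rng \<Longrightarrow> f \<in> Lp_fun p M"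
  and rng_P: "f \<in> rng \<Longrightarrow> AE x in M. P f x = f x"
  and rngI: "f \<in> Lp_fun p M \<Longrightarrow> AE x in M. P f x = f x \<Longrightarrow> f \<in> rng"
  by (simp_all add: rng_def)

lemma rng_measurable [measurable_dest]: "f \<in> rng \<Longrightarrow> f \<in> borel_measurable M"
  using rng_Lp Lp_fun_measurable by blast

lemma P_in_rng: "f \<in> Lp_fun p M \<Longrightarrow> P f \<in> rng"
  by (intro rngI P_Lp P_idem)

lemma rng_add:
  assumes "f \<in> rng" "g \<in> rng"
  shows "(\<lambda>x. f x + g x) \<in> rng"
proof (rule rngI)
  show "(\<lambda>x. f x + g x) \<in> Lp_fun p M"
    by (intro Lp_fun_add rng_Lp assms p0)
  show "AE x in M. P (\<lambda>x. f x + g x) x = f x + g x"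
    using P_add [OF assms [THEN rng_Lp]] assms [THEN rng_P] by eventually_elim simp
qed

lemma rng_scale:
  assumes "f \<in> rng"
  shows "(\<lambda>x. c * f x) \<in> rng"
proof (rule rngI)
  show "(\<lambda>x. c * f x) \<in> Lp_fun p M"
    by (intro Lp_fun_scale rng_Lp assms p0)
  show "AE x in M. P (\<lambda>x. c * f x) x = c * f x"
    using P_scale [OF rng_Lp [OF assms], of c] rng_P [OF assms] by eventually_elim simp
qed

lemma rng_diff: "f \<in> rng \<Longrightarrow> g \<in> rng \<Longrightarrow> (\<lambda>x. f x - g x) \<in> rng"
  using rng_add [of f "\<lambda>x. -1 * g x"] rng_scale [of g "-1"] by simp

text \<open>Almost everywhere \<open>P F - F\<close> equals \<open>P (F - f n) + (f n - F)\<close>,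
  and both terms tend to 0 in \<open>pint\<close> because \<open>P\<close> contracts. Limits of
  pointwise formulas enter \<open>rng\<close> through this lemma.\<close>

lemma rng_dominated:
  assumes f: "\<And>n. f n \<in> rng" and F: "F \<in> borel_measurable M" and h: "h \<in> Lp_fun p M"
    and lim: "\<And>x. (\<lambda>n. f n x) \<longlonglongrightarrow> F x"
    and bound: "\<And>n x. cmod (f n x) \<le> cmod (h x)"
  shows "F \<in> rng"
proof -
  note dom = p0(2) rng_Lp [OF f] F h AE_I2 [OF lim] AE_I2 [OF bound]
  have FL: "F \<in> Lp_fun p M"
    by (rule Lp_fun_dominated [OF dom])
  have PFL: "(\<lambda>x. P F x - F x) \<in> Lp_fun p M"
    using P_Lp [OF FL] FL p0 by (intro Lp_fun_diff)
  have "pint p M (\<lambda>x. P F x - F x) \<le> 2 powr p * (pint p M (\<lambda>x. f n x - F x) + pint p M (\<lambda>x. f n x - F x))" for n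
  proof -
    note fn = rng_Lp [OF f, of n]
    have d: "(\<lambda>x. F x - f n x) \<in> Lp_fun p M" "(\<lambda>x. f n x - F x) \<in> Lp_fun p M"
      using FL fn p0 by (auto intro!: Lp_fun_diff)
    have "AE x in M. P F x - F x = P (\<lambda>x. F x - f n x) x + (f n x - F x)"
      using P_diff [OF FL fn] rng_P [OF f, of n] by eventually_elim simp
    then have "pint p M (\<lambda>x. P F x - F x) = pint p M (\<lambda>x. P (\<lambda>x. F x - f n x) x + (f n x - F x))"
      by (rule pint_cong_AE [rotated 2]) (use PFL d P_Lp in auto)
    also have "\<dots> \<le> 2 powr p * (pint p M (P (\<lambda>x. F x - f n x)) + pint p M (\<lambda>x. f n x - F x))"
      by (intro pint_add_le P_Lp d p0)
    also have "\<dots> \<le> 2 powr p * (pint p M (\<lambda>x. f n x - F x) + pint p M (\<lambda>x. f n x - F x))"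
      using P_contr [OF d(1)] by (simp add: pint_minus_commute [of p M F])
    finally show ?thesis .
  qed
  moreover have "(\<lambda>n. 2 powr p * (pint p M (\<lambda>x. f n x - F x) + pint p M (\<lambda>x. f n x - F x))) \<longlonglongrightarrow> 2 powr p * (0 + 0)"
    by (intro tendsto_intros pint_dominated [OF dom])
  ultimately have "pint p M (\<lambda>x. P F x - F x) \<le> 0"
    using LIMSEQ_le_const by (metis (no_types, lifting) add_0 mult_zero_right)
  then have "AE x in M. P F x - F x = 0"
    using pint_nonneg [of p M "\<lambda>x. P F x - F x"] by (intro pint_eq_0D [OF PFL]) simp
  then show ?thesis
    by (intro rngI FL) auto
qed

section \<open>The kernel, its annihilator and the duality map\<close>

definition ker :: "('x \<Rightarrow> complex) set" where
  "ker = {k \<in> Lp_fun p M. AE x in M. P k x = 0}"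

lemma ker_Lp: "k \<in> ker \<Longrightarrow> k \<in> Lp_fun p M"
  by (simp add: ker_def)

text \<open>Elements of the range have minimal norm in their coset modulo the kernel, and
  \<open>dualp p f\<close> is the derivative of the norm at \<open>f\<close>.\<close>

lemma ker_orthogonal_rng:
  assumes p: "1 < p" and f: "f \<in> rng" and k: "k \<in> ker"
  shows "(\<integral>x. k x * dualp p (f x) \<partial>M) = 0"
proof -
  have [measurable]: "f \<in> borel_measurable M" "k \<in> borel_measurable M"
    using f k by (auto dest: ker_Lp)
  note fL = rng_Lp [OF f] and kL = ker_Lp [OF k]
  have nonneg: "0 \<le> Re (c * (\<integral>x. k x * dualp p (f x) \<partial>M))" for c
  proof -
    let ?e = "\<lambda>n. of_real (inverse (real (Suc n))) :: complex"
    let ?g = "\<lambda>n x. f x + ?e n * c * k x"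
    have gL: "?g n \<in> Lp_fun p M" for n
      using fL kL p0 by (intro Lp_fun_add Lp_fun_scale)
    \<comment> \<open>\<open>P\<close> sends \<open>?g n\<close> to \<open>f\<close>, so
      \<open>f\<close> has the smaller norm. The tangent bound is taken at \<open>?g n\<close> and
      evaluated at \<open>f\<close>, which yields the sign; continuity of \<open>dualp p\<close>
      then moves the base point to \<open>f\<close>.\<close>
    have "0 \<le> Re (c * (\<integral>x. k x * dualp p (?g n x) \<partial>M))" for n
    proof -
      have "AE x in M. f x = P (?g n) x"
        using P_add [OF fL Lp_fun_scale [OF kL p0(1)], of "?e n * c"] P_scale [OF kL, of "?e n * c"]
          rng_P [OF f] k unfolding ker_def by (auto elim!: eventually_elim2)
      then have "pint p M f = pint p M (P (?g n))"
        using P_Lp [OF gL] by (intro pint_cong_AE) auto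
      also have "\<dots> \<le> pint p M (?g n)"
        by (rule P_contr [OF gL])
      finally have "Re (\<integral>x. (f x - ?g n x) * dualp p (?g n x) \<partial>M) \<le> 0"
        using pint_tangent [OF p1 gL fL, of n] p by (smt (verit) mult_pos_pos)
      also have "(\<lambda>x. (f x - ?g n x) * dualp p (?g n x)) = (\<lambda>x. - ?e n * c * (k x * dualp p (?g n x)))"
        by (simp add: fun_eq_iff)
      finally have neg: "Re (- ?e n * (c * (\<integral>x. k x * dualp p (?g n x) \<partial>M))) \<le> 0"
        by (simp only: integral_mult_right_zero mult.assoc)
      have "0 \<le> Re w" if "Re (- of_real r * w) \<le> 0" "0 < r" for r w
        using that by (simp add: zero_le_mult_iff)
      from this [OF neg] show ?thesis by simp
    qed
    moreover have "(\<lambda>n. \<integral>x. k x * dualp p (?g n x) \<partial>M) \<longlonglongrightarrow> (\<integral>x. k x * dualp p (f x) \<partial>M)"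
    proof (rule integral_dominated_convergence)
      let ?h = "\<lambda>x. complex_of_real (cmod (f x) + cmod (c * k x))"
      have hL: "?h \<in> Lp_fun p M"
        using fL kL p0 by (intro Lp_fun_abs_add Lp_fun_scale)
      show "integrable M (\<lambda>x. cmod (k x * dualp p (?h x)))"
        by (intro integrable_norm integrable_mult_dualp p1 kL hL)
      show "AE x in M. (\<lambda>n. k x * dualp p (?g n x)) \<longlonglongrightarrow> k x * dualp p (f x)"
      proof (rule AE_I2)
        fix x
        have "(\<lambda>n. ?g n x) \<longlonglongrightarrow> f x + of_real 0 * c * k x"
          by (intro tendsto_intros LIMSEQ_inverse_real_of_nat)
        then have "(\<lambda>n. ?g n x) \<longlonglongrightarrow> f x" by simp
        then show "(\<lambda>n. k x * dualp p (?g n x)) \<longlonglongrightarrow> k x * dualp p (f x)"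
          by (intro tendsto_mult tendsto_const isCont_tendsto_compose [OF continuous_dualp [OF p]])
      qed
      show "AE x in M. norm (k x * dualp p (?g n x)) \<le> cmod (k x * dualp p (?h x))" for n
      proof (rule AE_I2)
        fix x
        have "cmod (?e n) \<le> 1" unfolding norm_of_real by (simp add: field_simps)
        then have "cmod (?e n * c * k x) \<le> cmod (c * k x)"
          by (simp only: norm_mult mult.assoc) (intro mult_left_le_one_le, auto)
        then have "cmod (?g n x) \<le> cmod (?h x)"
          using norm_triangle_ineq [of "f x" "?e n * c * k x"] unfolding norm_of_real by linarith
        then show "norm (k x * dualp p (?g n x)) \<le> cmod (k x * dualp p (?h x))"
          unfolding norm_mult cmod_dualp using p by (intro mult_left_mono powr_mono2) auto
      qed
    qed measurable
    ultimately show ?thesis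
      by (intro LIMSEQ_le_const [OF tendsto_Re [OF tendsto_mult [OF tendsto_const]]]) auto
  qed
  show ?thesis
    using nonneg [of 1] nonneg [of "-1"] nonneg [of \<i>] nonneg [of "-\<i>"]
    by (simp add: complex_eq_iff)
qed

text \<open>For the converse, \<open>P f - f\<close> lies in \<open>ker\<close> and is orthogonal to
  both \<open>dualp p (P f)\<close> and \<open>dualp p f\<close>. Its pairing with their difference
  has a nonnegative integrand, which therefore vanishes, and strict monotonicity gives
  \<open>P f = f\<close>.\<close>

lemma rng_iff_orthogonal_ker:
  assumes p: "1 < p" and f: "f \<in> Lp_fun p M"
  shows "f \<in> rng \<longleftrightarrow> (\<forall>k\<in>ker. (\<integral>x. k x * dualp p (f x) \<partial>M) = 0)"
proof
  assume orth: "\<forall>k\<in>ker. (\<integral>x. k x * dualp p (f x) \<partial>M) = 0"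
  let ?k = "\<lambda>x. P f x - f x"
  have kL: "?k \<in> Lp_fun p M"
    using P_Lp [OF f] f p0 by (intro Lp_fun_diff)
  have k: "?k \<in> ker"
    using kL P_diff [OF P_Lp [OF f] f] P_idem [OF f] by (auto simp: ker_def)
  have i: "integrable M (\<lambda>x. ?k x * dualp p (P f x))" "integrable M (\<lambda>x. ?k x * dualp p (f x))"
    by (intro integrable_mult_dualp p1 kL P_Lp f)+
  have i': "integrable M (\<lambda>x. ?k x * (dualp p (P f x) - dualp p (f x)))"
    unfolding right_diff_distrib [of "_ - _"] by (intro Bochner_Integration.integrable_diff i)
  have "(\<integral>x. ?k x * (dualp p (P f x) - dualp p (f x)) \<partial>M) = 0"
    unfolding right_diff_distrib [of "_ - _"]
    using i orth [rule_format, OF k] ker_orthogonal_rng [OF p P_in_rng [OF f] k] by simp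
  then have "(\<integral>x. Re (?k x * (dualp p (P f x) - dualp p (f x))) \<partial>M) = 0"
    using i' by (simp only: integral_Re) simp
  moreover have "0 \<le> Re ((z - u) * (dualp p z - dualp p u))" for z u
  proof -
    have "p * Re ((z - u) * dualp p u) + p * Re ((u - z) * dualp p z) \<le> 0"
      using powr_convex_tangent [OF p1, of u z] powr_convex_tangent [OF p1, of z u] by linarith
    moreover have "p * Re ((z - u) * dualp p u) + p * Re ((u - z) * dualp p z) =
        - (p * Re ((z - u) * (dualp p z - dualp p u)))"
      by (simp add: algebra_simps)
    ultimately show ?thesis using p by (simp add: zero_le_mult_iff)
  qed
  ultimately have "AE x in M. Re (?k x * (dualp p (P f x) - dualp p (f x))) = 0"
    by (subst (asm) integral_nonneg_eq_0_iff_AE) (auto intro: integrable_Re i' simp del: times_complex.sel)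
  then have "AE x in M. P f x = f x"
    by eventually_elim (rule dualp_strict_mono [OF p])
  then show "f \<in> rng"
    by (rule rngI [OF f])
qed (use ker_orthogonal_rng [OF p] in blast)

text \<open>With \<open>N\<close> the annihilator of \<open>ker\<close> in L^q,
  \<open>dualp p\<close> maps \<open>rng\<close> into \<open>N\<close> and \<open>dualp q\<close>
  maps \<open>N\<close> back. So \<open>abs_mult_sgn_closed\<close> applies to \<open>rng\<close>
  and \<open>N\<close> if \<open>p > 2\<close>, and with the two exchanged and exponent
  \<open>q > 2\<close> if \<open>p < 2\<close>; the latter result is carried back by
  \<open>dualp q\<close>.\<close>

lemma rng_abs_mult_sgn:
  assumes p: "1 < p" "p \<noteq> 2" and f: "f \<in> rng" and g: "g \<in> rng"
  shows "(\<lambda>x. of_real (cmod (f x)) * sgn (g x)) \<in> rng"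
proof -
  define q where "q = p / (p - 1)"
  have pq: "(p - 1) * (q - 1) = 1"
    using p by (simp add: q_def field_simps)
  then have qp: "(q - 1) * (p - 1) = 1" by (simp add: mult.commute)
  note q = conjugate_exponentD [OF p(1) pq]
  have q0: "0 \<le> q" using q by simp
  define N where "N = {u \<in> Lp_fun q M. \<forall>k\<in>ker. (\<integral>x. k x * u x \<partial>M) = 0}"
  have NL: "N \<subseteq> Lp_fun q M" by (auto simp: N_def)
  have intN: "integrable M (\<lambda>x. k x * u x)" if "k \<in> ker" "u \<in> Lp_fun q M" for k u
    using integrable_mult_dualp [OF p1 ker_Lp [OF that(1)] dualp_Lp_fun [OF q(1) qp that(2)]]
    by (simp add: dualp_dualp [OF qp])
  have addN: "(\<lambda>x. u x + v x) \<in> N" if "u \<in> N" "v \<in> N" for u v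
    using that intN Lp_fun_add [OF _ _ q0] by (auto simp: N_def distrib_left)
  have scaleN: "(\<lambda>x. c * u x) \<in> N" if "u \<in> N" for c u
    using that Lp_fun_scale [OF _ q0] by (auto simp: N_def mult.left_commute [of _ c])
  have domN: "F \<in> N" if u: "\<And>n. u n \<in> N" and F: "F \<in> borel_measurable M" and h: "h \<in> Lp_fun q M"
    and lim: "\<And>x. (\<lambda>n. u n x) \<longlonglongrightarrow> F x" and bound: "\<And>n x. cmod (u n x) \<le> cmod (h x)" for u F h
  proof -
    have uL: "u n \<in> Lp_fun q M" for n using u NL by auto
    have "F \<in> Lp_fun q M"
      using q by (intro Lp_fun_dominated [OF _ uL F h AE_I2 [OF lim] AE_I2 [OF bound]]) auto
    moreover have "(\<integral>x. k x * F x \<partial>M) = 0" if k: "k \<in> ker" for k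
    proof -
      have [measurable]: "k \<in> borel_measurable M" "F \<in> borel_measurable M" "u n \<in> borel_measurable M" for n
        using ker_Lp [OF k] F uL by auto
      have "(\<lambda>n. \<integral>x. k x * u n x \<partial>M) \<longlonglongrightarrow> (\<integral>x. k x * F x \<partial>M)"
      proof (rule integral_dominated_convergence)
        show "integrable M (\<lambda>x. cmod (k x * h x))"
          by (intro integrable_norm intN k h)
        show "AE x in M. (\<lambda>n. k x * u n x) \<longlonglongrightarrow> k x * F x"
          by (intro AE_I2 tendsto_mult tendsto_const lim)
        show "AE x in M. norm (k x * u n x) \<le> cmod (k x * h x)" for n
          using bound by (intro AE_I2) (simp add: norm_mult mult_left_mono)
      qed measurable
      moreover have "(\<lambda>n. \<integral>x. k x * u n x \<partial>M) = (\<lambda>n. 0)"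
        using u k by (auto simp: N_def)
      ultimately show ?thesis by (simp add: LIMSEQ_const_iff)
    qed
    ultimately show ?thesis by (simp add: N_def)
  qed
  have EN: "(\<lambda>x. dualp p (u x)) \<in> N" if "u \<in> rng" for u
    using dualp_Lp_fun [OF p(1) pq rng_Lp [OF that]] ker_orthogonal_rng [OF p(1) that] by (simp add: N_def)
  have NE: "(\<lambda>x. dualp q (u x)) \<in> rng" if "u \<in> N" for u
  proof -
    have "(\<lambda>x. dualp q (u x)) \<in> Lp_fun p M"
      using that NL by (intro dualp_Lp_fun [OF q(1) qp]) auto
    then show ?thesis
      using that by (simp add: rng_iff_orthogonal_ker [OF p(1)] dualp_dualp [OF qp] N_def)
  qed
  show ?thesis
  proof (cases "2 < p")
    case True
    show ?thesis
      by (rule abs_mult_sgn_closed [OF True pq _ rng_add rng_scale rng_dominated addN scaleN domN EN NE f g])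
        (auto simp: rng_Lp)
  next
    case False
    then have "p < 2" using p by simp
    then have q2: "2 < q" using p by (simp add: q_def field_simps)
    have "(\<lambda>x. of_real (cmod (dualp p (f x))) * sgn (dualp p (g x))) \<in> N"
      by (rule abs_mult_sgn_closed [OF q2 qp NL addN scaleN domN rng_add rng_scale rng_dominated NE EN EN [OF f] EN [OF g]])
    from NE [OF this]
    have "(\<lambda>x. dualp q (of_real (cmod (dualp p (f x))) * sgn (dualp p (g x)))) \<in> rng" .
    moreover have "of_real (cmod (dualp p z)) * sgn (dualp p w) = dualp p (of_real (cmod z) * sgn w)" for z w
    proof -
      have "sgn (cnj (sgn w)) = cnj (sgn w)" by (simp add: sgn_eq norm_divide)
      then show ?thesis
        by (cases "w = 0") (simp_all add: cmod_dualp dualp_def norm_mult norm_sgn sgn_mult sgn_of_real powr_mult)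
    qed
    ultimately show ?thesis
      by (simp add: dualp_dualp [OF pq])
  qed
qed

end


section \<open>Equality in the triangle inequality and the case \<open>p = 1\<close>\<close>

lemma add_cmod_eq_cmod_addD:
  fixes a b :: complex
  assumes "cmod a + cmod b = cmod (a + b)"
  shows "a = of_real (cmod a) * sgn (a + b)"
proof (cases "a + b = 0")
  case True
  then have "cmod a + cmod b = 0" using assms by simp
  then have "a = 0" by (smt (verit) norm_ge_zero norm_eq_zero)
  then show ?thesis by simp
next
  case False
  have "cmod a *\<^sub>R b = cmod b *\<^sub>R a"
    using assms norm_triangle_eq [of a b] by simp
  then have "cmod a *\<^sub>R (a + b) = cmod (a + b) *\<^sub>R a"
    by (simp add: assms [symmetric] scaleR_add_right scaleR_add_left)
  then show ?thesis
    using False by (simp add: sgn_eq scaleR_conv_of_real field_simps)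
qed

lemma pint_1_add_le:
  assumes "f \<in> Lp_fun 1 M" "g \<in> Lp_fun 1 M"
  shows "pint 1 M (\<lambda>x. f x + g x) \<le> pint 1 M f + pint 1 M g"
proof -
  have i: "integrable M (\<lambda>x. cmod (h x))" if "h \<in> Lp_fun 1 M" for h
    using Lp_fun_integrable [OF that] by simp
  have "(\<integral>x. cmod (f x + g x) \<partial>M) \<le> (\<integral>x. cmod (f x) + cmod (g x) \<partial>M)"
    using assms Lp_fun_add [OF assms] by (intro integral_mono i Bochner_Integration.integrable_add) (auto simp: norm_triangle_ineq)
  then show ?thesis
    using i [OF assms(1)] i [OF assms(2)] by (simp add: pint_def)
qed

text \<open>Recovers a real part from moduli, the only nonlinear expressions that
  \<open>rng_abs_mult_sgn\<close> supplies for \<open>p > 1\<close>.\<close>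

lemma tendsto_cmod_add_diff:
  assumes a: "0 < a"
  shows "(\<lambda>n. cmod (w + of_real (real n * a)) - real n * a) \<longlonglongrightarrow> Re w"
proof -
  have "(\<lambda>n. sqrt ((r + real n * a)\<^sup>2 + i\<^sup>2) - real n * a) \<longlonglongrightarrow> r" for r i :: real
    using a by real_asymp (simp add: field_simps)
  then show ?thesis by (simp add: cmod_def)
qed

context contractive_projection
begin

text \<open>For \<open>v = f - u\<close> the moduli of \<open>u\<close> and \<open>v\<close> add up
  to that of \<open>f\<close>. Hence the norms of \<open>P u\<close> and \<open>P v\<close> add up
  to at most the norm of \<open>f = P u + P v\<close>, so the triangle inequality is an equality
  almost everywhere, which aligns \<open>P u\<close> with \<open>f\<close>.\<close>

lemma rng_positive_L1_dominated:
  assumes p: "p = 1" and f: "f \<in> rng" and u: "u \<in> Lp_fun p M"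
    and u_pos: "\<And>x. u x = of_real (cmod (u x)) * sgn (f x)"
    and le: "\<And>x. cmod (u x) \<le> cmod (f x)"
  shows "AE x in M. P u x = of_real (cmod (P u x)) * sgn (f x)"
    and "pint p M (P u) = pint p M u"
proof -
  define v where "v = (\<lambda>x. f x - u x)"
  have v: "v \<in> Lp_fun p M"
    unfolding v_def by (intro Lp_fun_diff rng_Lp f u p0)
  have i: "integrable M (\<lambda>x. cmod (g x))" if "g \<in> Lp_fun p M" for g
    using Lp_fun_integrable [OF that] p by simp
  have pint: "pint p M g = (\<integral>x. cmod (g x) \<partial>M)" for g
    using p by (simp add: pint_def)
  have sum: "AE x in M. f x = P u x + P v x"
    using P_add [OF u v] rng_P [OF f] unfolding v_def by eventually_elim simp
  have "cmod (f x) = cmod (u x) + cmod (v x)" for x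
  proof (cases "f x = 0")
    case False
    have "v x = of_real (cmod (f x) - cmod (u x)) * sgn (f x)"
      unfolding v_def by (subst u_pos) (use False in \<open>simp add: sgn_eq algebra_simps\<close>)
    then have "cmod (v x) = cmod (f x) - cmod (u x)"
      using False le [of x] by (simp add: norm_mult norm_sgn del: of_real_diff)
    then show ?thesis by simp
  qed (use le [of x] in \<open>simp add: v_def\<close>)
  then have "pint p M f = pint p M u + pint p M v"
    using i u v by (simp add: pint)
  moreover have tri: "AE x in M. 0 \<le> cmod (P u x) + cmod (P v x) - cmod (f x)"
    using sum by eventually_elim (simp add: norm_triangle_ineq)
  moreover have int: "integrable M (\<lambda>x. cmod (P u x) + cmod (P v x) - cmod (f x))"
    by (intro Bochner_Integration.integrable_diff Bochner_Integration.integrable_add i P_Lp u v rng_Lp f)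
  moreover have eq: "(\<integral>x. cmod (P u x) + cmod (P v x) - cmod (f x) \<partial>M) =
      pint p M (P u) + pint p M (P v) - pint p M f"
    unfolding pint using i P_Lp u v rng_Lp [OF f] by simp
  ultimately have 0: "(\<integral>x. cmod (P u x) + cmod (P v x) - cmod (f x) \<partial>M) = 0"
    and "pint p M (P u) = pint p M u"
    using P_contr [OF u] P_contr [OF v] integral_nonneg_AE [OF tri] by auto
  show "pint p M (P u) = pint p M u" by fact
  have "AE x in M. cmod (P u x) + cmod (P v x) - cmod (f x) = 0"
    using 0 integral_nonneg_eq_0_iff_AE [OF int tri] by simp
  with sum show "AE x in M. P u x = of_real (cmod (P u x)) * sgn (f x)"
  proof eventually_elim
    case (elim x)
    then show ?case using add_cmod_eq_cmod_addD [of "P u x" "P v x"] by simp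
  qed
qed

text \<open>Truncating \<open>u\<close> at \<open>(n + 1) |f|\<close> reduces to the dominated case
  for the multiple \<open>(n + 1) f\<close>; alignment and norm survive the limit because
  \<open>P\<close> contracts.\<close>

lemma rng_positive_L1:
  assumes p: "p = 1" and f: "f \<in> rng" and u: "u \<in> Lp_fun p M"
    and u_pos: "\<And>x. u x = of_real (cmod (u x)) * sgn (f x)"
  shows "AE x in M. P u x = of_real (cmod (P u x)) * sgn (f x)"
    and "pint p M (P u) = pint p M u"
proof -
  have [measurable]: "u \<in> borel_measurable M" "f \<in> borel_measurable M"
    using u f by auto
  define U where "U = (\<lambda>n x. of_real (min (cmod (u x)) (real (Suc n) * cmod (f x))) * sgn (f x))"
  have cmod_U: "cmod (U n x) = min (cmod (u x)) (real (Suc n) * cmod (f x))" for n x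
    unfolding U_def norm_mult norm_of_real norm_sgn by (cases "f x = 0") auto
  have UL: "U n \<in> Lp_fun p M" for n
    by (rule Lp_fun_bound [OF _ u p0(1)]) (use cmod_U in \<open>auto simp: U_def\<close>)
  have U: "AE x in M. P (U n) x = of_real (cmod (P (U n) x)) * sgn (f x)" "pint p M (P (U n)) = pint p M (U n)" for n
  proof -
    have pos: "U n x = of_real (cmod (U n x)) * sgn (of_real (real (Suc n)) * f x)" for x
      unfolding cmod_U sgn_mult sgn_of_real by (simp add: U_def)
    have le: "cmod (U n x) \<le> cmod (of_real (real (Suc n)) * f x)" for x
      unfolding cmod_U norm_mult norm_of_real by simp
    show "pint p M (P (U n)) = pint p M (U n)"
      by (rule rng_positive_L1_dominated(2) [OF p rng_scale [OF f] UL pos le])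
    show "AE x in M. P (U n) x = of_real (cmod (P (U n) x)) * sgn (f x)"
      using rng_positive_L1_dominated(1) [OF p rng_scale [OF f] UL pos le]
      by (simp only: sgn_mult sgn_of_real) simp
  qed
  have lim: "(\<lambda>n. U n x) \<longlonglongrightarrow> u x" for x
  proof (cases "f x = 0")
    case True
    then show ?thesis using u_pos [of x] by (simp add: U_def)
  next
    case False
    obtain N where N: "cmod (u x) \<le> real N * cmod (f x)"
      using False reals_Archimedean3 [of "cmod (f x)"] by (meson less_imp_le zero_less_norm_iff)
    have "U n x = u x" if "N \<le> n" for n
    proof -
      have "real N * cmod (f x) \<le> real (Suc n) * cmod (f x)"
        using that by (intro mult_right_mono) auto
      then show ?thesis
        using N u_pos [of x] by (simp add: U_def min_absorb1 del: of_nat_Suc)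
    qed
    then show ?thesis
      by (intro tendsto_eventually eventually_sequentiallyI)
  qed
  have e: "(\<lambda>n. pint p M (\<lambda>x. U n x - u x)) \<longlonglongrightarrow> 0"
    by (rule pint_dominated [OF p0(2) UL _ u]) (use lim cmod_U in auto)
  let ?d = "\<lambda>n. pint p M (\<lambda>x. U n x - u x)"
  have Pd: "pint p M (P (\<lambda>x. U n x - u x)) \<le> ?d n" for n
    by (intro P_contr Lp_fun_diff UL u p0)
  have dL: "(\<lambda>x. U n x - u x) \<in> Lp_fun p M" for n
    by (intro Lp_fun_diff UL u p0)
  have "pint p M u \<le> pint p M (P u) + 2 * ?d n" for n
  proof -
    have "pint p M u \<le> pint p M (U n) + pint p M (\<lambda>x. u x - U n x)"
      using pint_1_add_le [of "U n" M "\<lambda>x. u x - U n x"] UL [of n] Lp_fun_diff [OF u UL p0(1), of n] p by simp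
    then have "pint p M u \<le> pint p M (U n) + ?d n"
      by (simp add: pint_minus_commute [of p M u])
    moreover have "pint p M (P (U n)) = pint p M (\<lambda>x. P u x + P (\<lambda>x. U n x - u x) x)"
      using P_diff [OF UL u, of n] P_Lp [OF UL, of n] P_Lp [OF dL, of n] P_Lp [OF u]
      by (intro pint_cong_AE) (auto elim: eventually_mono)
    moreover have "pint p M (\<lambda>x. P u x + P (\<lambda>x. U n x - u x) x) \<le> pint p M (P u) + pint p M (P (\<lambda>x. U n x - u x))"
      using pint_1_add_le P_Lp [OF u] P_Lp [OF dL, of n] p by metis
    ultimately show ?thesis using Pd [of n] U(2) [of n] by linarith
  qed
  then have "pint p M u \<le> pint p M (P u)"
    using tendsto_add [OF tendsto_const tendsto_mult [OF tendsto_const e], of "pint p M (P u)" 2]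
    by (intro LIMSEQ_le_const [of "\<lambda>n. pint p M (P u) + 2 * ?d n"]) auto
  with P_contr [OF u] show "pint p M (P u) = pint p M u" by simp
  \<comment> \<open>\<open>?r\<close> measures the failure of alignment. The same expression for
    \<open>U n\<close> vanishes, so \<open>?r\<close> is at most twice the modulus of
    \<open>P (U n - u)\<close>.\<close>
  let ?r = "\<lambda>x. P u x - of_real (cmod (P u x)) * sgn (f x)"
  have [measurable]: "P u \<in> borel_measurable M"
    using P_Lp [OF u] by auto
  have "cmod (?r x) \<le> cmod (2 * P u x)" for x
    using norm_triangle_ineq4 [of "P u x" "of_real (cmod (P u x)) * sgn (f x)"]
    by (simp add: norm_mult norm_sgn split: if_splits)
  then have rL: "?r \<in> Lp_fun p M"
    using Lp_fun_scale [OF P_Lp [OF u] p0(1), of 2] p0 by (intro Lp_fun_bound [of ?r M "\<lambda>x. 2 * P u x"]) auto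
  have "pint p M ?r \<le> 2 * ?d n" for n
  proof -
    have "pint p M ?r \<le> pint p M (\<lambda>x. 2 * P (\<lambda>x. U n x - u x) x)"
    proof (rule pint_mono [OF rL Lp_fun_scale [OF P_Lp [OF dL] p0(1)] p0(1)])
      show "AE x in M. cmod (?r x) \<le> cmod (2 * P (\<lambda>x. U n x - u x) x)"
        using P_diff [OF UL u, of n] U(1) [of n]
      proof eventually_elim
        case (elim x)
        let ?a = "P (U n) x" and ?b = "P u x"
        have "?r x = (?b - ?a) + of_real (cmod ?a - cmod ?b) * sgn (f x)"
          using elim(2) by (simp add: algebra_simps)
        then have "cmod (?r x) \<le> cmod (?b - ?a) + cmod (of_real (cmod ?a - cmod ?b) * sgn (f x))"
          using norm_triangle_ineq by metis
        also have "cmod (of_real (cmod ?a - cmod ?b) * sgn (f x)) \<le> \<bar>cmod ?a - cmod ?b\<bar>"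
          unfolding norm_mult norm_of_real norm_sgn by simp
        also have "\<dots> \<le> cmod (?a - ?b)" by (rule norm_triangle_ineq3)
        finally have "cmod (?r x) \<le> 2 * cmod (?a - ?b)"
          by (simp add: norm_minus_commute)
        then show ?case
          unfolding elim(1) norm_mult by simp
      qed
    qed
    also have "\<dots> \<le> 2 * ?d n"
      using Pd [of n] by (simp add: pint_scale p)
    finally show ?thesis .
  qed
  then have "pint p M ?r \<le> 0"
    using tendsto_mult [OF tendsto_const e, of 2]
    by (intro LIMSEQ_le_const [of "\<lambda>n. 2 * ?d n"]) auto
  then have "AE x in M. ?r x = 0"
    using pint_nonneg [of p M ?r] by (intro pint_eq_0D [OF rL]) simp
  then show "AE x in M. P u x = of_real (cmod (P u x)) * sgn (f x)"
    by eventually_elim simp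
qed

text \<open>Split \<open>g\<close> into \<open>u\<close> on the support of \<open>f\<close> and
  \<open>v\<close> off it. As \<open>P u\<close> is a multiple of \<open>sgn f\<close>,
  \<open>P v = v + (u - P u)\<close> has disjointly supported summands, and contractivity forces
  \<open>P u = u\<close>.\<close>

lemma rng_restrict_positive_part_L1:
  assumes p: "p = 1" and f: "f \<in> rng" and g: "g \<in> rng"
  shows "(\<lambda>x. if f x = 0 then 0 else g x) \<in> rng"
    and "(\<lambda>x. of_real (max 0 (Re (g x * cnj (sgn (f x))))) * sgn (f x)) \<in> rng"
proof -
  have [measurable]: "f \<in> borel_measurable M" "g \<in> borel_measurable M"
    using f g by auto
  note gL = rng_Lp [OF g]
  define real_mult where "real_mult r = (\<lambda>x. of_real (r x) * sgn (f x))" for r :: "'x \<Rightarrow> real"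
  have cmod_rm: "cmod (real_mult r x) = (if f x = 0 then 0 else \<bar>r x\<bar>)" for r x
    unfolding real_mult_def norm_mult norm_of_real norm_sgn by simp
  have rmL: "real_mult r \<in> Lp_fun p M" if [measurable]: "r \<in> borel_measurable M" and "\<And>x. \<bar>r x\<bar> \<le> cmod (g x)" for r
  proof -
    have "real_mult r \<in> borel_measurable M"
      unfolding real_mult_def by measurable
    then show ?thesis
      by (rule Lp_fun_bound [OF _ gL p0(1)]) (use that(2) in \<open>auto simp: cmod_rm\<close>)
  qed
  have pos: "real_mult r x = of_real (cmod (real_mult r x)) * sgn (f x)" if "\<And>x. 0 \<le> r x" for r x
    unfolding cmod_rm using that by (simp add: real_mult_def)
  \<comment> \<open>Aligned functions have aligned images; splitting \<open>r\<close> into positive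
    and negative parts shows that real multipliers of \<open>sgn f\<close> stay real.\<close>
  have P_real_mult: "AE x in M. P (real_mult r) x =
      of_real (cmod (P (real_mult (\<lambda>x. max 0 (r x))) x) - cmod (P (real_mult (\<lambda>x. max 0 (- r x))) x)) * sgn (f x)"
    if [measurable]: "r \<in> borel_measurable M" and r: "\<And>x. \<bar>r x\<bar> \<le> cmod (g x)" for r
  proof -
    have 1: "real_mult (\<lambda>x. max 0 (r x)) \<in> Lp_fun p M"
      using r by (intro rmL) (auto simp: max_def abs_le_iff)
    have 2: "real_mult (\<lambda>x. max 0 (- r x)) \<in> Lp_fun p M"
      using r by (intro rmL) (auto simp: max_def abs_le_iff)
    have "real_mult r = (\<lambda>x. real_mult (\<lambda>x. max 0 (r x)) x - real_mult (\<lambda>x. max 0 (- r x)) x)"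
      by (auto simp: real_mult_def fun_eq_iff max_def)
    then have eq: "(\<lambda>x. real_mult (\<lambda>x. max 0 (r x)) x - real_mult (\<lambda>x. max 0 (- r x)) x) = real_mult r"
      by (rule sym)
    have "AE x in M. P (real_mult (\<lambda>x. max 0 (r x))) x =
        of_real (cmod (P (real_mult (\<lambda>x. max 0 (r x))) x)) * sgn (f x)"
      by (rule rng_positive_L1(1) [OF p f 1 pos]) simp
    moreover have "AE x in M. P (real_mult (\<lambda>x. max 0 (- r x))) x =
        of_real (cmod (P (real_mult (\<lambda>x. max 0 (- r x))) x)) * sgn (f x)"
      by (rule rng_positive_L1(1) [OF p f 2 pos]) simp
    ultimately show ?thesis
      using P_diff [OF 1 2, unfolded eq]
    proof eventually_elim
      case (elim x)
      show ?case
        unfolding elim(3) of_real_diff left_diff_distrib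
        by (rule arg_cong2 [where f = "(-)", OF elim(1) elim(2)])
    qed
  qed
  define a b where "a x = Re (g x * cnj (sgn (f x)))" and "b x = Im (g x * cnj (sgn (f x)))" for x
  have [measurable]: "a \<in> borel_measurable M" "b \<in> borel_measurable M"
    unfolding a_def [abs_def] b_def [abs_def] by measurable
  have le: "\<bar>a x\<bar> \<le> cmod (g x)" "\<bar>b x\<bar> \<le> cmod (g x)" for x
  proof -
    have "cmod (g x * cnj (sgn (f x))) \<le> cmod (g x)"
      by (simp add: norm_mult norm_sgn)
    then show "\<bar>a x\<bar> \<le> cmod (g x)" "\<bar>b x\<bar> \<le> cmod (g x)"
      unfolding a_def b_def by (meson abs_Re_le_cmod abs_Im_le_cmod order_trans)+
  qed
  define u where "u = (\<lambda>x. real_mult a x + \<i> * real_mult b x)"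
  have u_eq: "u x = (if f x = 0 then 0 else g x)" for x
  proof (cases "f x = 0")
    case False
    have "u x = (g x * cnj (sgn (f x))) * sgn (f x)"
      unfolding u_def real_mult_def a_def b_def by (subst complex_eq [of "g x * _"]) (simp add: algebra_simps)
    also have "\<dots> = g x"
      using complex_norm_square [of "sgn (f x)"] False by (simp add: norm_sgn mult.commute mult.left_commute)
    finally show ?thesis using False by simp
  qed (simp add: u_def real_mult_def)
  have aL: "real_mult a \<in> Lp_fun p M" and bL: "real_mult b \<in> Lp_fun p M"
    by (intro rmL le; measurable)+
  have uL: "u \<in> Lp_fun p M"
    unfolding u_def by (intro Lp_fun_add Lp_fun_scale aL bL p0)
  have P_u: "AE x in M. P u x = P (real_mult a) x + \<i> * P (real_mult b) x"
    using P_add [OF aL Lp_fun_scale [OF bL p0(1)], of \<i>] P_scale [OF bL, of \<i>] unfolding u_def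
    by eventually_elim simp
  have Pa: "AE x in M. \<exists>s. P (real_mult a) x = of_real s * sgn (f x)"
    by (rule eventually_mono [OF P_real_mult [OF _ le(1)]]) (measurable, blast)
  have Pb: "AE x in M. \<exists>s. P (real_mult b) x = of_real s * sgn (f x)"
    by (rule eventually_mono [OF P_real_mult [OF _ le(2)]]) (measurable, blast)
  define v where "v = (\<lambda>x. g x - u x)"
  have vL: "v \<in> Lp_fun p M"
    unfolding v_def by (intro Lp_fun_diff gL uL p0)
  have dL: "(\<lambda>x. u x - P u x) \<in> Lp_fun p M"
    by (intro Lp_fun_diff P_Lp uL p0)
  have i: "integrable M (\<lambda>x. cmod (h x))" if "h \<in> Lp_fun p M" for h
    using Lp_fun_integrable [OF that] p by simp
  have "AE x in M. cmod (P v x) = cmod (v x) + cmod (u x - P u x)"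
    using P_diff [OF gL uL] rng_P [OF g] P_u Pa Pb unfolding v_def
  proof eventually_elim
    case (elim x)
    then show ?case by (cases "f x = 0") (auto simp: u_eq)
  qed
  then have "pint p M (P v) = (\<integral>x. cmod (v x) + cmod (u x - P u x) \<partial>M)"
    using P_Lp [OF vL] vL dL unfolding pint_def by (intro integral_cong_AE) (auto simp: p)
  also have "\<dots> = pint p M v + pint p M (\<lambda>x. u x - P u x)"
    using i [OF vL] i [OF dL] by (simp add: pint_def p)
  finally have "pint p M (\<lambda>x. u x - P u x) = 0"
    using P_contr [OF vL] pint_nonneg [of p M "\<lambda>x. u x - P u x"] by simp
  from pint_eq_0D [OF dL this] have Pu: "AE x in M. P u x = u x"
    by eventually_elim simp
  then have "u \<in> rng" by (rule rngI [OF uL])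
  then show "(\<lambda>x. if f x = 0 then 0 else g x) \<in> rng"
    by (simp add: u_eq [abs_def])
  let ?a = "real_mult (\<lambda>x. max 0 (a x))"
  have cmod_sgn: "z * sgn w = z' * sgn w \<Longrightarrow> w \<noteq> 0 \<Longrightarrow> z = z'" for z z' w :: complex
    by (simp add: sgn_zero_iff)
  \<comment> \<open>The images of \<open>real_mult a\<close> and \<open>real_mult b\<close> have
    real coefficients, so \<open>P u = u\<close> can be compared in real and imaginary
    parts.\<close>
  have Paa: "AE x in M. P (real_mult a) x = real_mult a x"
    using Pu P_u Pa Pb
  proof eventually_elim
    case (elim x)
    then obtain s t where st: "P (real_mult a) x = of_real s * sgn (f x)" "P (real_mult b) x = of_real t * sgn (f x)"
      by blast
    show ?case
    proof (cases "f x = 0")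
      case False
      have "(of_real s + \<i> * of_real t) * sgn (f x) = (of_real (a x) + \<i> * of_real (b x)) * sgn (f x)"
        using elim st unfolding u_def real_mult_def by (simp add: algebra_simps)
      from cmod_sgn [OF this False] have "s = a x"
        by (simp add: complex_eq_iff)
      then show ?thesis using st by (simp add: real_mult_def)
    qed (use st in \<open>simp add: real_mult_def\<close>)
  qed
  have apL: "?a \<in> Lp_fun p M"
    using le by (intro rmL) (auto simp: max_def abs_le_iff)
  have Pra: "AE x in M. P (real_mult a) x =
      of_real (cmod (P ?a x) - cmod (P (real_mult (\<lambda>x. max 0 (- a x))) x)) * sgn (f x)"
    by (rule P_real_mult [OF _ le(1)]) measurable
  \<comment> \<open>\<open>a\<close> is a difference of two nonnegative coefficients, the first
    being that of \<open>P ?a\<close>, so \<open>P ?a\<close> dominates the positive part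
    \<open>?a\<close>. Their norms agree, which leaves only equality.\<close>
  have "AE x in M. cmod (P ?a x) - cmod (?a x) \<ge> 0"
    using Paa Pra
  proof eventually_elim
    case (elim x)
    show ?case
    proof (cases "f x = 0")
      case False
      then have "a x = cmod (P ?a x) - cmod (P (real_mult (\<lambda>x. max 0 (- a x))) x)"
        using elim by (metis cmod_sgn of_real_eq_iff real_mult_def)
      then have "a x \<le> cmod (P ?a x)" by (smt (verit) norm_ge_zero)
      then show ?thesis by (simp add: cmod_rm)
    qed (simp add: cmod_rm)
  qed
  moreover have "(\<integral>x. cmod (P ?a x) - cmod (?a x) \<partial>M) = 0"
    using rng_positive_L1(2) [OF p f apL pos] i [OF apL] i [OF P_Lp [OF apL]] by (simp add: pint_def p)
  ultimately have "AE x in M. cmod (P ?a x) - cmod (?a x) = 0"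
    using integral_nonneg_eq_0_iff_AE [of M "\<lambda>x. cmod (P ?a x) - cmod (?a x)"] i [OF apL] i [OF P_Lp [OF apL]] by simp
  moreover have "AE x in M. P ?a x = of_real (cmod (P ?a x)) * sgn (f x)"
    by (rule rng_positive_L1(1) [OF p f apL pos]) simp
  ultimately have "AE x in M. P ?a x = ?a x"
  proof eventually_elim
    case (elim x)
    have "?a x = of_real (cmod (?a x)) * sgn (f x)" by (rule pos) simp
    then show ?case using elim by simp
  qed
  then have "?a \<in> rng" by (rule rngI [OF apL])
  then show "(\<lambda>x. of_real (max 0 (Re (g x * cnj (sgn (f x))))) * sgn (f x)) \<in> rng"
    by (simp add: real_mult_def a_def)
qed

text \<open>For \<open>p > 1\<close> apply \<open>rng_abs_mult_sgn\<close> twice: \<open>|g|\<close>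
  times the sign of \<open>|f| sgn g\<close> is \<open>g\<close> where \<open>f\<close> is nonzero
  and 0 elsewhere.\<close>

lemma rng_restrict:
  assumes p: "p \<noteq> 2" and f: "f \<in> rng" and g: "g \<in> rng"
  shows "(\<lambda>x. if f x = 0 then 0 else g x) \<in> rng"
proof (cases "p = 1")
  case False
  then have "1 < p" using p1 by simp
  note abs_sgn = rng_abs_mult_sgn [OF this p]
  have "of_real (cmod (g x)) * sgn (of_real (cmod (f x)) * sgn (g x)) = (if f x = 0 then 0 else g x)" for x
  proof -
    have "of_real (cmod (g x)) * sgn (g x) = g x"
      by (cases "g x = 0") (simp_all add: sgn_eq)
    then show ?thesis
      by (cases "f x = 0") (simp_all add: sgn_mult sgn_of_real)
  qed
  with abs_sgn [OF g abs_sgn [OF f g]] show ?thesis by simp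
qed (rule rng_restrict_positive_part_L1 [OF _ f g])

text \<open>For \<open>p > 1\<close> the functions \<open>|g + n f| sgn f - n f\<close> stay in
  \<open>rng\<close> and tend to the real component of \<open>g\<close> along \<open>f\<close>;
  averaging it with its modulus times \<open>sgn f\<close> leaves the positive part. The point is
  its support: the set where \<open>g / f\<close> has positive real part becomes available to
  \<open>rng_restrict\<close>.\<close>

lemma rng_positive_part:
  assumes p: "p \<noteq> 2" and f: "f \<in> rng" and g: "g \<in> rng"
  shows "(\<lambda>x. of_real (max 0 (Re (g x * cnj (sgn (f x))))) * sgn (f x)) \<in> rng"
proof (cases "p = 1")
  case False
  then have "1 < p" using p1 by simp
  note abs_sgn = rng_abs_mult_sgn [OF this p]
  have [measurable]: "f \<in> borel_measurable M" "g \<in> borel_measurable M"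
    using f g by auto
  let ?r = "\<lambda>x. of_real (Re (g x * cnj (sgn (f x)))) * sgn (f x)"
  let ?s = "\<lambda>n x. of_real (cmod (g x + of_real (real n) * f x)) * sgn (f x) - of_real (real n) * f x"
  have s: "?s n x = of_real (cmod (g x * cnj (sgn (f x)) + of_real (real n * cmod (f x))) - real n * cmod (f x)) * sgn (f x)"
    for n x
  proof (cases "f x = 0")
    case False
    have unit: "cnj (sgn (f x)) * f x = of_real (cmod (f x))"
      using False by (simp add: sgn_eq complex_norm_square [symmetric] power2_eq_square mult.commute)
    have "cmod (g x + of_real (real n) * f x) = cmod ((g x + of_real (real n) * f x) * cnj (sgn (f x)))"
      using False by (simp add: norm_mult norm_sgn)
    also have "(g x + of_real (real n) * f x) * cnj (sgn (f x)) = g x * cnj (sgn (f x)) + of_real (real n * cmod (f x))"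
      using unit by (simp add: algebra_simps)
    finally show ?thesis
      using False by (simp add: sgn_eq algebra_simps)
  qed simp
  have r: "?r \<in> rng"
  proof (rule rng_dominated)
    show "?s n \<in> rng" for n
      by (intro rng_diff abs_sgn rng_add rng_scale f g)
    show "?r \<in> borel_measurable M" by measurable
    show "g \<in> Lp_fun p M" by (rule rng_Lp [OF g])
    show "(\<lambda>n. ?s n x) \<longlonglongrightarrow> ?r x" for x
      unfolding s
      by (cases "f x = 0") (simp, intro tendsto_mult tendsto_of_real tendsto_cmod_add_diff tendsto_const, simp)
    show "cmod (?s n x) \<le> cmod (g x)" for n x
    proof -
      let ?w = "g x * cnj (sgn (f x))" and ?t = "real n * cmod (f x)"
      have "cmod (?s n x) \<le> \<bar>cmod (?w + of_real ?t) - ?t\<bar>"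
        unfolding s norm_mult norm_of_real norm_sgn by simp
      also have "\<dots> \<le> cmod ?w"
        using norm_triangle_ineq3 [of "?w + of_real ?t" "of_real ?t"] unfolding norm_of_real by simp
      also have "\<dots> \<le> cmod (g x)"
        by (simp add: norm_mult norm_sgn)
      finally show ?thesis .
    qed
  qed
  have "of_real (1 / 2) * (of_real (cmod (of_real t * sgn (f x))) * sgn (f x) + of_real t * sgn (f x)) =
      of_real (max 0 t) * sgn (f x)" for t x
    unfolding norm_mult norm_of_real norm_sgn
    by (cases "f x = 0"; cases "0 \<le> t") auto
  with rng_scale [OF rng_add [OF abs_sgn [OF r f] r], of "of_real (1 / 2)"] show ?thesis
    by (simp only:)
qed (rule rng_restrict_positive_part_L1 [OF _ f g])

end

section \<open>Representations and the numerical range\<close>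

lemma scaleC_one [simp]: "1 *\<^sub>C (a :: 'a::complex_banach_algebra_1) = a"
  using scaleC_of_real [of 1 a] by simp

lemma scaleC_zero_left [simp]: "0 *\<^sub>C (a :: 'a::complex_banach_algebra_1) = 0"
  using scaleC_of_real [of 0 a] by simp

lemma scaleC_zero_right [simp]: "c *\<^sub>C (0 :: 'a::complex_banach_algebra_1) = 0"
  using norm_scaleC [of c "0 :: 'a"] by simp

lemma scaleC_ii_of_real: "(\<i> * complex_of_real t) *\<^sub>C (a :: 'a::complex_banach_algebra_1) = t *\<^sub>R (\<i> *\<^sub>C a)"
  by (metis mult.commute scaleC_of_real scaleC_scaleC)

text \<open>For small \<open>h\<close> the exponential differs from \<open>1 + h A\<close> by at
  most \<open>e |h|\<close>, so it shrinks norms at most by the factor \<open>1 - e |h|\<close>.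
  Dividing \<open>- t\<close> into \<open>n\<close> such steps and letting \<open>e\<close> tend to
  0 shows that \<open>exp (- t A)\<close> shrinks nothing; applied to \<open>exp (t A)\<close>, this
  bounds the norm of the latter by 1.\<close>

lemma norm_exp_scaleR_eq_1:
  fixes A :: "'a::{real_normed_algebra_1,banach}"
  assumes A: "\<And>t b. norm b \<le> norm ((1 + t *\<^sub>R A) * b)"
  shows "norm (exp (t *\<^sub>R A)) = 1"
proof -
  let ?E = "\<lambda>t. exp (t *\<^sub>R A)"
  have inv: "?E (- t) * ?E t = 1" for t
    by (simp flip: exp_add_commuting)
  have le: "(1 - e * \<bar>t\<bar>) * norm (?E t) \<le> 1" if e: "0 < e" for e t
  proof -
    have "(?E has_vector_derivative A) (at 0)"
      using exp_scaleR_has_vector_derivative_left [of A 0] by simp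
    then obtain d where d: "0 < d" and dE: "\<And>h. \<bar>h\<bar> < d \<Longrightarrow> norm (?E h - 1 - h *\<^sub>R A) \<le> e * \<bar>h\<bar>"
      using e unfolding has_vector_derivative_def has_derivative_at_alt by force
    have step: "(1 - e * \<bar>h\<bar>) * norm b \<le> norm (?E h * b)" if "\<bar>h\<bar> < d" for h b
    proof -
      have "(1 + h *\<^sub>R A) * b = ?E h * b - (?E h - 1 - h *\<^sub>R A) * b"
        by (simp add: algebra_simps)
      then have "norm ((1 + h *\<^sub>R A) * b) \<le> norm (?E h * b) + norm ((?E h - 1 - h *\<^sub>R A) * b)"
        using norm_triangle_ineq4 by metis
      also have "norm ((?E h - 1 - h *\<^sub>R A) * b) \<le> (e * \<bar>h\<bar>) * norm b"
        using dE [OF that] by (meson mult_right_mono norm_ge_zero norm_mult_ineq order_trans)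
      finally show ?thesis
        using A [of b h] by (simp add: algebra_simps)
    qed
    \<comment> \<open>The summands ensure in turn that \<open>|h| < d\<close>, that
      \<open>e |h| \<le> 1\<close>, and that \<open>n\<close> is positive.\<close>
    obtain n :: nat where n: "\<bar>t\<bar> / d + e * \<bar>t\<bar> + 1 < real n"
      using reals_Archimedean2 by blast
    then have n0: "0 < real n" using d e by (smt (verit) divide_nonneg_pos mult_nonneg_nonneg)
    define h where "h = - t / real n"
    have h: "\<bar>h\<bar> < d" "e * \<bar>h\<bar> \<le> 1" "real n * \<bar>h\<bar> = \<bar>t\<bar>" "real n * h = - t"
    proof -
      have "\<bar>t\<bar> / d < real n" using n e by (smt (verit) mult_nonneg_nonneg)
      then show "\<bar>h\<bar> < d" using d n0 by (simp add: h_def field_simps)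
      have "e * \<bar>t\<bar> \<le> real n" using n d by (smt (verit) divide_nonneg_pos)
      then show "e * \<bar>h\<bar> \<le> 1" using n0 by (simp add: h_def field_simps)
    qed (use n0 in \<open>auto simp: h_def\<close>)
    have pow: "(1 - e * \<bar>h\<bar>) ^ k * norm b \<le> norm (?E h ^ k * b)" for k b
    proof (induction k arbitrary: b)
      case (Suc k)
      have "(1 - e * \<bar>h\<bar>) ^ Suc k * norm b = (1 - e * \<bar>h\<bar>) ^ k * ((1 - e * \<bar>h\<bar>) * norm b)"
        by simp
      also have "\<dots> \<le> (1 - e * \<bar>h\<bar>) ^ k * norm (?E h * b)"
        using h by (intro mult_left_mono step) auto
      also have "\<dots> \<le> norm (?E h ^ k * (?E h * b))"
        by (rule Suc)
      also have "?E h ^ k * (?E h * b) = ?E h ^ Suc k * b"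
        by (simp add: power_Suc2 mult.assoc del: power_Suc)
      finally show ?case .
    qed simp
    have "?E h ^ k = ?E (real k * h)" for k
    proof (induction k)
      case (Suc k)
      have "?E (h + real k * h) = ?E h * ?E (real k * h)"
        by (simp add: exp_add_commuting scaleR_add_left)
      with Suc show ?case by (simp add: algebra_simps)
    qed simp
    from this [of n] have "?E h ^ n = ?E (- t)"
      by (simp only: h(4))
    then have "(1 - e * \<bar>h\<bar>) ^ n * norm (?E t) \<le> 1"
      using pow [of n "?E t"] inv [of t] by simp
    \<comment> \<open>Bernoulli's inequality replaces the \<open>n\<close>-th power by a bound in
      which \<open>n\<close> and \<open>h\<close> occur only through
      \<open>n |h| = |t|\<close>.\<close>
    moreover have "1 + real n * (- (e * \<bar>h\<bar>)) \<le> (1 + - (e * \<bar>h\<bar>)) ^ n"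
      using h by (intro Bernoulli_inequality) simp
    moreover have "1 + real n * (- (e * \<bar>h\<bar>)) = 1 - e * \<bar>t\<bar>"
      using h(3) by (simp add: mult.left_commute)
    ultimately show ?thesis
      by (smt (verit) mult_right_mono norm_ge_zero)
  qed
  have le1: "norm (?E t) \<le> 1" for t
  proof (rule LIMSEQ_le_const2)
    show "(\<lambda>n. (1 - inverse (real (Suc n)) * \<bar>t\<bar>) * norm (?E t)) \<longlonglongrightarrow> norm (?E t)"
      using tendsto_mult [OF tendsto_diff [OF tendsto_const [of 1] tendsto_mult [OF LIMSEQ_inverse_real_of_nat tendsto_const]] tendsto_const]
      by fastforce
  qed (use le in auto)
  have "1 \<le> norm (?E (- t)) * norm (?E t)"
    using norm_mult_ineq [of "?E (- t)" "?E t"] inv [of t] by simp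
  then show ?thesis
    using le1 [of t] le1 [of "- t"] by (smt (verit) mult_left_le_one_le norm_ge_zero)
qed

text \<open>Representatives replace classes, hence laws that hold almost everywhere.
  \<open>T_bound\<close> and \<open>norm_le\<close> together say that \<open>norm a\<close> is the
  operator norm, in \<open>p\<close>-th powers.\<close>

locale Lp_representation =
  fixes p :: real and M :: "'x measure"
    and T :: "'a::complex_banach_algebra_1 \<Rightarrow> ('x \<Rightarrow> complex) \<Rightarrow> 'x \<Rightarrow> complex"
  assumes p_ge_1: "1 \<le> p"
    and T_Lp: "\<And>a f. f \<in> Lp_fun p M \<Longrightarrow> T a f \<in> Lp_fun p M"
    and T_add_right: "\<And>a f g. f \<in> Lp_fun p M \<Longrightarrow> g \<in> Lp_fun p M \<Longrightarrow>
      AE x in M. T a (\<lambda>x. f x + g x) x = T a f x + T a g x"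
    and T_scale_right: "\<And>a c f. f \<in> Lp_fun p M \<Longrightarrow> AE x in M. T a (\<lambda>x. c * f x) x = c * T a f x"
    and T_add: "\<And>a b f. f \<in> Lp_fun p M \<Longrightarrow> AE x in M. T (a + b) f x = T a f x + T b f x"
    and T_scaleC: "\<And>c a f. f \<in> Lp_fun p M \<Longrightarrow> AE x in M. T (c *\<^sub>C a) f x = c * T a f x"
    and T_mult: "\<And>a b f. f \<in> Lp_fun p M \<Longrightarrow> AE x in M. T (a * b) f x = T a (T b f) x"
    and T_bound: "\<And>a f. f \<in> Lp_fun p M \<Longrightarrow> pint p M (T a f) \<le> norm a powr p * pint p M f"
    and norm_le: "\<And>a K. 0 \<le> K \<Longrightarrow>
      (\<And>f. f \<in> Lp_fun p M \<Longrightarrow> pint p M (T a f) \<le> K powr p * pint p M f) \<Longrightarrow> norm a \<le> K"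
begin

sublocale contractive_projection p M "T 1"
proof unfold_locales
  show "AE x in M. T 1 (T 1 f) x = T 1 f x" if "f \<in> Lp_fun p M" for f
    using T_mult [OF that, of 1 1] by eventually_elim simp
qed (use p_ge_1 T_Lp T_add_right T_scale_right T_bound [of _ 1] in auto)

lemma T_diff_right:
  assumes "f \<in> Lp_fun p M" "g \<in> Lp_fun p M"
  shows "AE x in M. T a (\<lambda>x. f x - g x) x = T a f x - T a g x"
  using T_add_right [OF assms(1) Lp_fun_scale [OF assms(2) p0(1), of "-1"], of a] T_scale_right [OF assms(2), of a "-1"]
  by eventually_elim simp

lemma T_in_rng: "f \<in> Lp_fun p M \<Longrightarrow> T a f \<in> rng"
  using T_mult [of f 1 a] by (intro rngI T_Lp) (simp_all add: eq_commute)

text \<open>\<open>T a f\<close> and \<open>T a (T 1 f)\<close> agree almost everywhere and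
  \<open>T 1\<close> contracts, so the norm is already seen on \<open>rng\<close>.\<close>

lemma norm_le_of_rng:
  assumes "0 \<le> K" and K: "\<And>f. f \<in> rng \<Longrightarrow> pint p M (T a f) \<le> K powr p * pint p M f"
  shows "norm a \<le> K"
proof (rule norm_le [OF assms(1)])
  fix f assume f: "f \<in> Lp_fun p M"
  have "pint p M (T a f) = pint p M (T a (T 1 f))"
    using T_mult [OF f, of a 1] T_Lp f by (intro pint_cong_AE) auto
  also have "\<dots> \<le> K powr p * pint p M (T 1 f)"
    by (intro K P_in_rng f)
  also have "\<dots> \<le> K powr p * pint p M f"
    by (intro mult_left_mono P_contr f) simp
  finally show "pint p M (T a f) \<le> K powr p * pint p M f" .
qed

lemma norm_mono:
  assumes "\<And>f. f \<in> rng \<Longrightarrow> pint p M (T a f) \<le> pint p M (T b f)"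
  shows "norm a \<le> norm b"
proof (rule norm_le_of_rng)
  show "pint p M (T a f) \<le> norm b powr p * pint p M f" if "f \<in> rng" for f
    using assms [OF that] T_bound [OF rng_Lp [OF that], of b] by simp
qed simp

lemma eq_of_rng:
  assumes "\<And>f. f \<in> rng \<Longrightarrow> AE x in M. T a f x = T b f x"
  shows "a = b"
proof -
  have "norm (a + (-1) *\<^sub>C b) \<le> 0"
  proof (rule norm_le_of_rng)
    fix f assume f: "f \<in> rng"
    note fL = rng_Lp [OF f]
    have "AE x in M. T (a + (-1) *\<^sub>C b) f x = 0"
      using T_add [OF fL, of a "(-1) *\<^sub>C b"] T_scaleC [OF fL, of "-1" b] assms [OF f]
      by eventually_elim simp
    then have "pint p M (T (a + (-1) *\<^sub>C b) f) = pint p M (\<lambda>x. 0)"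
      by (intro pint_cong_AE) (use T_Lp [OF fL] in auto)
    then show "pint p M (T (a + (-1) *\<^sub>C b) f) \<le> 0 powr p * pint p M f"
      by (simp add: pint_def)
  qed simp
  moreover have "(-1) *\<^sub>C b = - b"
    using scaleC_of_real [of "-1" b] by simp
  ultimately show ?thesis by simp
qed

text \<open>An unnormalised state: for \<open>f\<close> in \<open>rng\<close> its value at 1 is
  \<open>pint p M f\<close>, and its norm is at most that. Leaving out the division keeps
  \<open>f = 0\<close> unexceptional.\<close>

definition state :: "('x \<Rightarrow> complex) \<Rightarrow> 'a \<Rightarrow> complex" where
  "state f a = (\<integral>x. T a f x * dualp p (f x) \<partial>M)"

lemma integrable_T_dualp:
  "f \<in> Lp_fun p M \<Longrightarrow> g \<in> Lp_fun p M \<Longrightarrow> integrable M (\<lambda>x. T a f x * dualp p (g x))"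
  by (intro integrable_mult_dualp p1 T_Lp)

lemma integral_cong_mult_dualp:
  assumes "f \<in> Lp_fun p M" "g \<in> Lp_fun p M" "h \<in> Lp_fun p M" "AE x in M. f x = g x"
  shows "(\<integral>x. f x * dualp p (h x) \<partial>M) = (\<integral>x. g x * dualp p (h x) \<partial>M)"
  by (rule integral_cong_AE) (use assms in \<open>auto elim: eventually_mono\<close>)

lemma state_add:
  assumes f: "f \<in> Lp_fun p M"
  shows "state f (a + b) = state f a + state f b"
proof -
  have "state f (a + b) = (\<integral>x. (T a f x + T b f x) * dualp p (f x) \<partial>M)"
    unfolding state_def by (intro integral_cong_mult_dualp T_Lp Lp_fun_add f p0 T_add)
  then show ?thesis
    by (simp add: state_def distrib_right integrable_T_dualp f)
qed

lemma state_scaleC: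
  assumes f: "f \<in> Lp_fun p M"
  shows "state f (c *\<^sub>C a) = c * state f a"
proof -
  have "state f (c *\<^sub>C a) = (\<integral>x. (c * T a f x) * dualp p (f x) \<partial>M)"
    unfolding state_def by (intro integral_cong_mult_dualp T_Lp Lp_fun_scale f p0 T_scaleC)
  then show ?thesis
    by (simp add: state_def mult.assoc)
qed

lemma state_scaleR: "f \<in> Lp_fun p M \<Longrightarrow> state f (r *\<^sub>R a) = of_real r * state f a"
  using state_scaleC [of f "of_real r" a] by (simp add: scaleC_of_real)

lemma state_1: "f \<in> rng \<Longrightarrow> state f 1 = of_real (pint p M f)"
  unfolding state_def
  by (subst integral_cong_mult_dualp [OF _ _ _ rng_P])
    (auto intro: P_Lp rng_Lp simp: integral_mult_dualp_self)

text \<open>If \<open>norm b \<le> 1\<close>, then \<open>T b\<close> does not increase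
  \<open>pint\<close>, and the tangent bound from \<open>f\<close> to \<open>T b f\<close> gives
  \<open>Re (state f b) \<le> pint p M f\<close>. A phase factor and division by the norm pass to
  the modulus.\<close>

lemma norm_state_le:
  assumes f: "f \<in> rng"
  shows "cmod (state f a) \<le> norm a * pint p M f"
proof -
  note fL = rng_Lp [OF f]
  have le: "Re (state f b) \<le> pint p M f" if "norm b \<le> 1" for b
  proof -
    have "norm b powr p \<le> 1 powr p" using that p0 by (intro powr_mono2) auto
    then have "pint p M (T b f) \<le> pint p M f"
      using T_bound [OF fL, of b] mult_right_mono [of "norm b powr p" 1 "pint p M f"] pint_nonneg [of p M f] by simp
    then have "p * Re (\<integral>x. (T b f x - f x) * dualp p (f x) \<partial>M) \<le> 0"
      using pint_tangent [OF p1 fL T_Lp [OF fL], of b] by simp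
    moreover have "(\<integral>x. (T b f x - f x) * dualp p (f x) \<partial>M) = state f b - of_real (pint p M f)"
      using integrable_mult_dualp [OF p1 fL fL]
      by (simp add: left_diff_distrib integrable_T_dualp fL state_def flip: integral_mult_dualp_self)
    ultimately show ?thesis using p0 by (simp add: mult_le_0_iff)
  qed
  show ?thesis
  proof (cases "a = 0")
    case True
    then show ?thesis using state_scaleC [OF fL, of 0 0] by simp
  next
    case False
    let ?c = "cnj (sgn (state f a)) / of_real (norm a)"
    have "norm (?c *\<^sub>C a) \<le> 1"
      using False by (simp add: norm_scaleC norm_divide norm_sgn)
    moreover have "state f (?c *\<^sub>C a) = of_real (cmod (state f a) / norm a)"
      unfolding state_scaleC [OF fL] using mult_dualp [of "state f a" 1]
      by (cases "state f a = 0") (simp_all add: dualp_def mult.commute)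
    ultimately have "cmod (state f a) / norm a \<le> pint p M f"
      using le [of "?c *\<^sub>C a"] by simp
    then show ?thesis using False by (simp add: field_simps)
  qed
qed

lemma bounded_linear_state: "f \<in> rng \<Longrightarrow> bounded_linear (state f)"
  by (rule bounded_linear_intro [of _ "pint p M f"])
    (simp_all add: norm_state_le state_add state_scaleR rng_Lp scaleR_conv_of_real [where 'a = complex])

text \<open>Lumer: an element is hermitian iff its numerical range with respect to the functionals
  \<open>state f\<close> is real.\<close>

lemma hermitian_iff_state: "hermitian a \<longleftrightarrow> (\<forall>f\<in>rng. Im (state f a) = 0)"
proof
  assume herm: "hermitian a"
  show "\<forall>f\<in>rng. Im (state f a) = 0"
  proof
    fix f assume f: "f \<in> rng"
    let ?E = "\<lambda>t. exp (t *\<^sub>R (\<i> *\<^sub>C a))"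
    have "(?E has_vector_derivative \<i> *\<^sub>C a) (at 0)"
      using exp_scaleR_has_vector_derivative_left [of "\<i> *\<^sub>C a" 0] by simp
    from bounded_linear.has_vector_derivative [OF bounded_linear_compose [OF bounded_linear_Re bounded_linear_state [OF f]] this]
    have "((\<lambda>t. Re (state f (?E t))) has_real_derivative Re (state f (\<i> *\<^sub>C a))) (at 0)"
      by (simp add: has_real_derivative_iff_has_vector_derivative)
    \<comment> \<open>Along this curve of elements of norm 1 the state is bounded by
      \<open>pint p M f\<close>, its value at \<open>t = 0\<close>, so \<open>t = 0\<close> is a
      maximum.\<close>
    then have "Re (state f (\<i> *\<^sub>C a)) = 0"
    proof (rule DERIV_local_max [where d = 1])
      show "\<forall>t. \<bar>0 - t\<bar> < 1 \<longrightarrow> Re (state f (?E t)) \<le> Re (state f (?E 0))"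
      proof (intro allI impI)
        fix t
        have "norm (?E t) = 1"
          using herm by (simp add: hermitian_def scaleC_ii_of_real)
        then have "Re (state f (?E t)) \<le> pint p M f"
          using norm_state_le [OF f, of "?E t"] complex_Re_le_cmod [of "state f (?E t)"] by simp
        then show "Re (state f (?E t)) \<le> Re (state f (?E 0))"
          using state_1 [OF f] by simp
      qed
    qed simp
    then show "Im (state f a) = 0"
      by (simp add: state_scaleC rng_Lp [OF f])
  qed
next
  assume real: "\<forall>f\<in>rng. Im (state f a) = 0"
  \<comment> \<open>At \<open>u = T b f\<close> the linear term in the tangent bound is the real
    part of \<open>\<i> t * state u a\<close>, which is 0; so \<open>u + \<i> t T a u\<close> is no
    shorter than \<open>u\<close>.\<close>
  have "norm b \<le> norm ((1 + t *\<^sub>R (\<i> *\<^sub>C a)) * b)" for t b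
  proof (rule norm_mono)
    fix f assume f: "f \<in> rng"
    note fL = rng_Lp [OF f]
    let ?c = "\<i> * complex_of_real t"
    define u where "u = T b f"
    have u: "u \<in> rng" unfolding u_def by (rule T_in_rng [OF fL])
    note uL = rng_Lp [OF u]
    have cL: "(\<lambda>x. ?c * T a u x) \<in> Lp_fun p M"
      by (intro Lp_fun_scale T_Lp uL p0)
    have "AE x in M. T ((1 + t *\<^sub>R (\<i> *\<^sub>C a)) * b) f x = u x + ?c * T a u x"
      using T_mult [OF fL, of "1 + ?c *\<^sub>C a" b] T_add [OF uL, of 1 "?c *\<^sub>C a"] T_scaleC [OF uL, of ?c a] rng_P [OF u]
      unfolding u_def [symmetric] scaleC_ii_of_real by eventually_elim simp
    then have eq: "pint p M (T ((1 + t *\<^sub>R (\<i> *\<^sub>C a)) * b) f) = pint p M (\<lambda>x. u x + ?c * T a u x)"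
      using T_Lp [OF fL] Lp_fun_add [OF uL cL p0(1)] by (intro pint_cong_AE) auto
    have "(\<integral>x. (u x + ?c * T a u x - u x) * dualp p (u x) \<partial>M) = ?c * state u a"
      by (simp add: state_def mult.assoc)
    moreover have "Re (?c * state u a) = 0"
      using real u by simp
    ultimately have "Re (\<integral>x. (u x + ?c * T a u x - u x) * dualp p (u x) \<partial>M) = 0"
      by (simp only:)
    then have "pint p M u \<le> pint p M (\<lambda>x. u x + ?c * T a u x)"
      using pint_tangent [OF p1 uL Lp_fun_add [OF uL cL p0(1)]] by (simp only: mult_zero_right add_0_right)
    then show "pint p M (T b f) \<le> pint p M (T ((1 + t *\<^sub>R (\<i> *\<^sub>C a)) * b) f)"
      unfolding eq by (simp add: u_def)
  qed
  then have "norm (exp (t *\<^sub>R (\<i> *\<^sub>C a))) = 1" for t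
    by (rule norm_exp_scaleR_eq_1)
  then show "hermitian a"
    by (simp add: hermitian_def scaleC_ii_of_real)
qed

lemma hermitian_1: "hermitian (1 :: 'a)"
  by (simp add: hermitian_iff_state state_1)

lemma hermitian_add: "hermitian a \<Longrightarrow> hermitian b \<Longrightarrow> hermitian (a + b)"
  for a b :: 'a
  by (simp add: hermitian_iff_state state_add rng_Lp)

lemma hermitian_scaleR: "hermitian a \<Longrightarrow> hermitian (r *\<^sub>R a)"
  for a :: 'a
  by (simp add: hermitian_iff_state state_scaleR rng_Lp)

lemma hermitian_limit:
  fixes a :: 'a
  assumes "\<And>n. hermitian (s n)" "s \<longlonglongrightarrow> a"
  shows "hermitian a"
  unfolding hermitian_iff_state
proof
  fix f assume f: "f \<in> rng"
  have "(\<lambda>n. Im (state f (s n))) \<longlonglongrightarrow> Im (state f a)"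
    by (intro tendsto_Im bounded_linear.tendsto [OF bounded_linear_state [OF f]] assms(2))
  moreover have "(\<lambda>n. Im (state f (s n))) = (\<lambda>n. 0)"
    using assms(1) f by (simp add: hermitian_iff_state)
  ultimately show "Im (state f a) = 0"
    by (simp add: LIMSEQ_const_iff)
qed

end

section \<open>Hermitian elements\<close>

lemma real_quotient:
  fixes u h :: complex
  assumes "Im (u * cnj h) = 0" "h \<noteq> 0"
  shows "\<exists>m. u = of_real m * h"
proof -
  have "u * cnj h = of_real (Re (u * cnj h))"
    using assms by (simp add: complex_eq_iff)
  then have "u * (h * cnj h) = of_real (Re (u * cnj h)) * h"
    by (metis mult.assoc mult.commute)
  then have "u = of_real (Re (u * cnj h) / (cmod h)\<^sup>2) * h"
    using assms(2) by (simp add: complex_norm_square [symmetric] field_simps)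
  then show ?thesis ..
qed

text \<open>With real ratios \<open>m\<close> and \<open>n\<close>, the conditions for
  \<open>f + g\<close> and \<open>f + \<i> g\<close> say that \<open>m - n\<close> times the
  imaginary and the real part of \<open>f * cnj g\<close> vanishes. One sum alone would say nothing
  when that part is 0.\<close>

lemma mult_eq_of_real_quotients:
  fixes f g z w :: complex
  assumes 0: "f = 0 \<longrightarrow> z = 0" "g = 0 \<longrightarrow> w = 0"
    and real: "Im (z * cnj f) = 0" "Im (w * cnj g) = 0"
    and "Im ((z + w) * cnj (f + g)) = 0" "Im ((z + \<i> * w) * cnj (f + \<i> * g)) = 0"
  shows "z * g = w * f"
proof (cases "f = 0 \<or> g = 0")
  case False
  from real_quotient [OF real(1)] real_quotient [OF real(2)] False
  obtain m n where z: "z = of_real m * f" and w: "w = of_real n * g" by blast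
  have "(m - n) * Im (f * cnj g) = 0" "(m - n) * Re (f * cnj g) = 0"
    using assms(5,6) unfolding z w by (simp_all add: algebra_simps)
  moreover have "f * cnj g \<noteq> 0" using False by simp
  ultimately have "m = n" by (auto simp: complex_eq_iff simp del: times_complex.sel)
  then show ?thesis by (simp add: z w)
qed (use 0 in auto)

context Lp_representation
begin

lemma state_real: "hermitian a \<Longrightarrow> f \<in> rng \<Longrightarrow> Im (state f a) = 0"
  by (simp add: hermitian_iff_state)

lemma T_comb:
  assumes "f \<in> rng" "g \<in> rng"
  shows "AE x in M. T a (\<lambda>x. f x + c * g x) x = T a f x + c * T a g x"
  using T_add_right [OF rng_Lp [OF assms(1)] rng_Lp [OF rng_scale [OF assms(2)]], of a c]
    T_scale_right [OF rng_Lp [OF assms(2)], of a c]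
  by eventually_elim simp

text \<open>The additivity assumption holds if \<open>p = 2\<close> and also if \<open>f\<close> and \<open>g\<close> have disjoint
  supports; these cases lead to the two halves of the argument.\<close>

lemma hermitian_cross_terms:
  assumes a: "hermitian a" and f: "f \<in> rng" and g: "g \<in> rng"
    and add: "AE x in M. dualp p (f x + c * g x) = dualp p (f x) + dualp p (c * g x)"
  shows "Im (dualp p c * (\<integral>x. T a f x * dualp p (g x) \<partial>M) + c * (\<integral>x. T a g x * dualp p (f x) \<partial>M)) = 0"
proof -
  note fL = rng_Lp [OF f] and gL = rng_Lp [OF g]
  have u: "(\<lambda>x. f x + c * g x) \<in> rng"
    by (intro rng_add rng_scale f g)
  have [measurable]: "f \<in> borel_measurable M" "g \<in> borel_measurable M" "T a f \<in> borel_measurable M"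
    "T a g \<in> borel_measurable M" "T a (\<lambda>x. f x + c * g x) \<in> borel_measurable M"
    using fL gL T_Lp rng_Lp [OF u] by auto
  have "state (\<lambda>x. f x + c * g x) a = (\<integral>x. T a f x * dualp p (f x) + dualp p c * (T a f x * dualp p (g x)) +
      c * (T a g x * dualp p (f x)) + (c * dualp p c) * (T a g x * dualp p (g x)) \<partial>M)"
    unfolding state_def
  proof (rule integral_cong_AE)
    show "AE x in M. T a (\<lambda>x. f x + c * g x) x * dualp p (f x + c * g x) =
        T a f x * dualp p (f x) + dualp p c * (T a f x * dualp p (g x)) +
        c * (T a g x * dualp p (f x)) + (c * dualp p c) * (T a g x * dualp p (g x))"
      using T_comb [OF f g, of a c] add
      by eventually_elim (simp add: dualp_mult algebra_simps)
  qed measurable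
  also have "\<dots> = state f a + dualp p c * (\<integral>x. T a f x * dualp p (g x) \<partial>M) +
      c * (\<integral>x. T a g x * dualp p (f x) \<partial>M) + of_real (cmod c powr p) * state g a"
    by (simp add: state_def integrable_T_dualp fL gL flip: mult_dualp)
  finally have "Im (state (\<lambda>x. f x + c * g x) a) = Im (state f a) +
      Im (dualp p c * (\<integral>x. T a f x * dualp p (g x) \<partial>M) + c * (\<integral>x. T a g x * dualp p (f x) \<partial>M)) +
      cmod c powr p * Im (state g a)"
    by simp
  then show ?thesis
    using state_real [OF a u] state_real [OF a f] state_real [OF a g] by simp
qed

subsection \<open>The case \<open>p \<noteq> 2\<close>\<close>

text \<open>Replacing \<open>g\<close> by \<open>c g\<close> scales the two cross terms by
  \<open>dualp p c\<close> and \<open>c\<close>, whose moduli at \<open>c = 2\<close> are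
  \<open>2 powr (p - 1)\<close> and 2. These differ as \<open>p \<noteq> 2\<close>, so the values 1,
  2, \<i> and 2\<i> of \<open>c\<close> separate the two integrals.\<close>

lemma hermitian_disjoint_orthogonal:
  assumes p: "p \<noteq> 2" and a: "hermitian a" and f: "f \<in> rng" and g: "g \<in> rng"
    and disj: "AE x in M. f x * g x = 0"
  shows "(\<integral>x. T a f x * dualp p (g x) \<partial>M) = 0"
proof -
  let ?X = "\<integral>x. T a f x * dualp p (g x) \<partial>M" and ?Y = "\<integral>x. T a g x * dualp p (f x) \<partial>M"
  have cross: "Im (dualp p c * ?X + c * ?Y) = 0" for c
    by (rule hermitian_cross_terms [OF a f g]) (use disj in \<open>eventually_elim, auto\<close>)
  define k :: real where "k = 2 powr (p - 1)"
  have "k \<noteq> 2 powr 1"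
    unfolding k_def using p by (subst powr_inj) auto
  then have k: "k - 2 \<noteq> 0" by simp
  have J: "dualp p 1 = 1" "dualp p \<i> = - \<i>" "dualp p 2 = of_real k" "dualp p (2 * \<i>) = of_real k * (- \<i>)"
    by (simp_all add: dualp_mult [of p 2 \<i>] dualp_def k_def sgn_eq)
  have solve: "(k - 2) * Im X = 0 \<and> (k - 2) * Re X = 0"
    if "Im (1 * X + 1 * Y) = 0" "Im (of_real k * X + 2 * Y) = 0" "Im (- \<i> * X + \<i> * Y) = 0"
      "Im (of_real k * (- \<i>) * X + 2 * \<i> * Y) = 0" for X Y
  proof -
    have "Im X + Im Y = 0" "k * Im X + 2 * Im Y = 0" "Re Y - Re X = 0" "2 * Re Y - k * Re X = 0"
      using that by simp_all
    then show ?thesis unfolding left_diff_distrib by linarith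
  qed
  have "(k - 2) * Im ?X = 0 \<and> (k - 2) * Re ?X = 0"
    using cross [of 1] cross [of 2] cross [of \<i>] cross [of "2 * \<i>"] unfolding J
    by (rule solve)
  with k show ?thesis by (simp add: complex_eq_iff)
qed

text \<open>The part \<open>?g\<close> of \<open>T a f\<close> off the support of \<open>f\<close>
  lies in \<open>rng\<close> by \<open>rng_restrict\<close> and is disjoint from \<open>f\<close>.
  The pairing of \<open>T a f\<close> with it is \<open>pint p M ?g\<close>, which must
  vanish.\<close>

lemma hermitian_local:
  assumes p: "p \<noteq> 2" and a: "hermitian a" and f: "f \<in> rng"
  shows "AE x in M. f x = 0 \<longrightarrow> T a f x = 0"
proof -
  let ?h = "T a f"
  let ?g = "\<lambda>x. ?h x - (if f x = 0 then 0 else ?h x)"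
  have h: "?h \<in> rng" by (rule T_in_rng [OF rng_Lp [OF f]])
  have g: "?g \<in> rng" by (intro rng_diff rng_restrict p f h)
  have "(\<integral>x. ?h x * dualp p (?g x) \<partial>M) = 0"
    by (rule hermitian_disjoint_orthogonal [OF p a f g]) auto
  moreover have "?h x * dualp p (?g x) = ?g x * dualp p (?g x)" for x
    by simp
  ultimately have "pint p M ?g = 0"
    unfolding integral_mult_dualp_self by (simp only: integral_mult_dualp_self of_real_eq_0_iff)
  from pint_eq_0D [OF rng_Lp [OF g] this] show ?thesis
    by eventually_elim auto
qed

text \<open>Write \<open>f\<close> as its restriction plus the remainder; by locality each image
  vanishes where its argument does.\<close>

lemma hermitian_restrict:
  assumes p: "p \<noteq> 2" and a: "hermitian a" and f: "f \<in> rng" and h: "h \<in> rng"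
  shows "AE x in M. T a (\<lambda>x. if h x = 0 then 0 else f x) x = (if h x = 0 then 0 else T a f x)"
proof -
  let ?f1 = "\<lambda>x. if h x = 0 then 0 else f x"
  have f1: "?f1 \<in> rng" by (rule rng_restrict [OF p h f])
  have f2: "(\<lambda>x. f x - ?f1 x) \<in> rng" by (rule rng_diff [OF f f1])
  show ?thesis
    using hermitian_local [OF p a f1] hermitian_local [OF p a f2] T_diff_right [OF rng_Lp [OF f] rng_Lp [OF f1], of a]
    by eventually_elim auto
qed

text \<open>If \<open>s * Im (T a f * cnj f)\<close> were positive on a set that is not null,
  cutting \<open>f\<close> to this set would give a state with nonzero imaginary part. The cut is
  permitted because the set is the support of an element of \<open>rng\<close>, the positive part of
  \<open>- s \<i> T a f\<close> relative to \<open>f\<close>.\<close>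

lemma hermitian_real_quotient:
  assumes p: "p \<noteq> 2" and a: "hermitian a" and f: "f \<in> rng"
  shows "AE x in M. Im (T a f x * cnj (f x)) = 0"
proof -
  note fL = rng_Lp [OF f]
  have Tf: "T a f \<in> rng" by (rule T_in_rng [OF fL])
  have [measurable]: "f \<in> borel_measurable M" "T a f \<in> borel_measurable M"
    using fL Tf by auto
  have le: "AE x in M. s * Im (T a f x * cnj (f x)) \<le> 0" if s: "s = 1 \<or> s = -1" for s :: real
  proof -
    let ?m = "\<lambda>x. max 0 (Re (of_real s * (- \<i>) * T a f x * cnj (sgn (f x))))"
    let ?u = "\<lambda>x. of_real (?m x) * sgn (f x)"
    let ?f1 = "\<lambda>x. if ?u x = 0 then 0 else f x"
    let ?r = "\<lambda>x. s * Im (if ?u x = 0 then 0 else T a f x * dualp p (f x))"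
    have u: "?u \<in> rng"
      by (rule rng_positive_part [OF p f rng_scale [OF Tf]])
    have f1: "?f1 \<in> rng" by (rule rng_restrict [OF p u f])
    have u0: "?u x = 0 \<longleftrightarrow> f x = 0 \<or> ?m x = 0" for x
      by (auto simp: sgn_zero_iff)
    have re: "Re (of_real s * (- \<i>) * T a f x * cnj (sgn (f x))) * cmod (f x) powr (p - 1) =
        s * Im (T a f x * dualp p (f x))" for x
      by (simp add: dualp_def algebra_simps)
    have r: "?r x = ?m x * cmod (f x) powr (p - 1)" for x
    proof (cases "?u x = 0")
      case True
      then have "?m x * cmod (f x) powr (p - 1) = 0"
        unfolding u0 by auto
      then show ?thesis unfolding if_P [OF True] by simp
    next
      case False
      then have "?m x = Re (of_real s * (- \<i>) * T a f x * cnj (sgn (f x)))"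
        unfolding u0 by linarith
      then show ?thesis using False re [of x] by (simp only: if_False)
    qed
    have int: "integrable M (\<lambda>x. if ?u x = 0 then 0 else T a f x * dualp p (f x))"
    proof (rule Bochner_Integration.integrable_bound [OF integrable_T_dualp [OF fL fL, of a]])
      have "norm (if c then 0 else z) \<le> norm z" for c and z :: complex
        by simp
      then show "AE x in M. norm (if ?u x = 0 then 0 else T a f x * dualp p (f x)) \<le> norm (T a f x * dualp p (f x))"
        by (intro AE_I2)
    qed measurable
    have if_cases: "(if c then 0 else z) * dualp p (if c then 0 else w) = (if c then 0 else z * dualp p w)"
      for c z w
      by simp
    have "state ?f1 a = (\<integral>x. (if ?u x = 0 then 0 else T a f x * dualp p (f x)) \<partial>M)"
      unfolding state_def
    proof (rule integral_cong_AE)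
      show "AE x in M. T a ?f1 x * dualp p (?f1 x) = (if ?u x = 0 then 0 else T a f x * dualp p (f x))"
        using hermitian_restrict [OF p a f u]
      proof eventually_elim
        case (elim x)
        show ?case unfolding elim by (rule if_cases)
      qed
    qed (use T_Lp [OF rng_Lp [OF f1]] in measurable)
    with state_real [OF a f1] have "(\<integral>x. ?r x \<partial>M) = 0"
      using integral_Im [OF int] by simp
    moreover have "integrable M ?r"
      by (intro integrable_mult_right integrable_Im int)
    moreover have "AE x in M. 0 \<le> ?r x"
      unfolding r by (intro AE_I2 mult_nonneg_nonneg) auto
    ultimately have "AE x in M. ?r x = 0"
      by (simp only: integral_nonneg_eq_0_iff_AE)
    then show ?thesis
    proof eventually_elim
      case (elim x)
      show ?case
      proof (cases "f x = 0")
        case False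
        have "?m x = 0 \<or> cmod (f x) powr (p - 1) = 0"
          using elim unfolding r by (simp only: mult_eq_0_iff)
        then have "?m x = 0"
          using False by (simp only: powr_eq_0_iff norm_eq_zero simp_thms)
        then have "Re (of_real s * (- \<i>) * T a f x * cnj (sgn (f x))) \<le> 0" by linarith
        moreover have "s * Im (T a f x * cnj (f x)) =
            Re (of_real s * (- \<i>) * T a f x * cnj (sgn (f x))) * cmod (f x)"
          using False by (simp add: sgn_eq field_simps)
        ultimately show ?thesis
          by (simp only: mult_nonpos_nonneg norm_ge_zero)
      qed simp
    qed
  qed
  from le [OF disjI1 [OF refl]] le [OF disjI2 [OF refl]] show ?thesis
  proof eventually_elim
    case (elim x)
    then show ?case by linarith
  qed
qed

text \<open>Reality of the ratios for \<open>f + g\<close> and \<open>f + \<i> g\<close> forces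
  \<open>T a f / f\<close> and \<open>T a g / g\<close> to agree where both are defined: the
  multiplier depends on \<open>a\<close> alone.\<close>

lemma hermitian_swap:
  assumes p: "p \<noteq> 2" and a: "hermitian a" and f: "f \<in> rng" and g: "g \<in> rng"
  shows "AE x in M. T a f x * g x = T a g x * f x"
  using hermitian_local [OF p a f] hermitian_local [OF p a g]
    hermitian_real_quotient [OF p a f] hermitian_real_quotient [OF p a g]
    hermitian_real_quotient [OF p a rng_add [OF f rng_scale [OF g, of 1]]] T_comb [OF f g, of a 1]
    hermitian_real_quotient [OF p a rng_add [OF f rng_scale [OF g, of \<i>]]] T_comb [OF f g, of a \<i>]
  by eventually_elim (rule mult_eq_of_real_quotients, simp_all del: times_complex.sel plus_complex.sel)

text \<open>By \<open>hermitian_swap\<close>, \<open>f * T a (T b f)\<close> and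
  \<open>f * T b (T a f)\<close> both equal \<open>T a f * T b f\<close>; on the zeros of
  \<open>f\<close> locality makes both products of operators vanish.\<close>

lemma hermitian_commute:
  fixes a b :: 'a
  assumes p: "p \<noteq> 2" and a: "hermitian a" and b: "hermitian b"
  shows "a * b = b * a"
proof (rule eq_of_rng)
  fix f assume f: "f \<in> rng"
  note fL = rng_Lp [OF f]
  have Tf: "T a f \<in> rng" "T b f \<in> rng" by (intro T_in_rng fL)+
  show "AE x in M. T (a * b) f x = T (b * a) f x"
    using T_mult [OF fL, of a b] T_mult [OF fL, of b a] hermitian_swap [OF p a Tf(2) f] hermitian_swap [OF p b Tf(1) f]
      hermitian_local [OF p a f] hermitian_local [OF p b f] hermitian_local [OF p a Tf(2)] hermitian_local [OF p b Tf(1)]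
  proof eventually_elim
    case (elim x)
    then have "f x * T a (T b f) x = f x * T b (T a f) x"
      by (simp add: mult.commute)
    with elim show ?case by (cases "f x = 0") auto
  qed
qed

lemma hermitian_quotients:
  assumes p: "p \<noteq> 2" and a: "hermitian a" and f: "f \<in> rng"
  shows "AE x in M. \<exists>m. T a f x = of_real m * f x"
  using hermitian_local [OF p a f] hermitian_real_quotient [OF p a f]
proof eventually_elim
  case (elim x)
  show ?case
  proof (cases "f x = 0")
    case False
    show ?thesis by (rule real_quotient [OF elim(2) False])
  qed (use elim in auto)
qed

text \<open>On the support of \<open>f\<close> the product acts by the product of two real ratios,
  so the integrand of its state is real.\<close>

lemma hermitian_mult:
  fixes a b :: 'a
  assumes p: "p \<noteq> 2" and a: "hermitian a" and b: "hermitian b"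
  shows "hermitian (a * b)"
  unfolding hermitian_iff_state
proof
  fix f assume f: "f \<in> rng"
  note fL = rng_Lp [OF f]
  have Tb: "T b f \<in> rng" by (intro T_in_rng fL)
  have "AE x in M. Im (T (a * b) f x * dualp p (f x)) = 0"
    using T_mult [OF fL, of a b] hermitian_swap [OF p a Tb f] hermitian_quotients [OF p a f]
      hermitian_quotients [OF p b f]
  proof eventually_elim
    case (elim x)
    then obtain m n where m: "T a f x = of_real m * f x" and n: "T b f x = of_real n * f x"
      by blast
    show ?case
    proof (cases "f x = 0")
      case False
      then have "T (a * b) f x = of_real (m * n) * f x"
        using elim(1,2) by (simp add: m n)
      then have "T (a * b) f x * dualp p (f x) = of_real (m * n * cmod (f x) powr p)"
        by (simp add: mult.assoc mult_dualp)
      then show ?thesis by (simp only: Im_complex_of_real)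
    qed simp
  qed
  then have "(\<integral>x. Im (T (a * b) f x * dualp p (f x)) \<partial>M) = 0"
    by (intro integral_eq_zero_AE)
  then show "Im (state f (a * b)) = 0"
    using integral_Im [OF integrable_T_dualp [OF fL fL, of "a * b"]] by (simp add: state_def)
qed

lemma T_add_ii:
  assumes f: "f \<in> Lp_fun p M"
  shows "AE x in M. T (a + \<i> *\<^sub>C b) f x = T a f x + \<i> * T b f x"
  using T_add [OF f, of a "\<i> *\<^sub>C b"] T_scaleC [OF f, of \<i> b] by eventually_elim simp

lemma norm_hermitian_part_le_not_2:
  fixes a b :: 'a
  assumes p: "p \<noteq> 2" and a: "hermitian a" and b: "hermitian b"
  shows "norm a \<le> norm (a + \<i> *\<^sub>C b)"
proof (rule norm_mono)
  fix f assume f: "f \<in> rng"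
  note fL = rng_Lp [OF f]
  show "pint p M (T a f) \<le> pint p M (T (a + \<i> *\<^sub>C b) f)"
  proof (intro pint_mono T_Lp fL p0)
    show "AE x in M. cmod (T a f x) \<le> cmod (T (a + \<i> *\<^sub>C b) f x)"
      using T_add_ii [OF fL, of a b] hermitian_quotients [OF p a f] hermitian_quotients [OF p b f]
    proof eventually_elim
      case (elim x)
      then obtain m n where mn: "T a f x = of_real m * f x" "T b f x = of_real n * f x"
        by blast
      have "T (a + \<i> *\<^sub>C b) f x = Complex m n * f x"
        unfolding elim(1) mn by (simp add: Complex_eq algebra_simps)
      moreover have "\<bar>m\<bar> \<le> cmod (Complex m n)"
        using abs_Re_le_cmod [of "Complex m n"] by simp
      ultimately show ?case
        by (simp add: mn norm_mult mult_right_mono)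
    qed
  qed
qed

subsection \<open>The case \<open>p = 2\<close>\<close>

text \<open>For \<open>p = 2\<close> the duality map is conjugation, hence additive, and the
  cross-term identity holds for all \<open>f\<close>, \<open>g\<close> and \<open>c\<close>;
  \<open>c = 1\<close> and \<open>c = \<i>\<close> compare imaginary and real parts.\<close>

lemma hermitian_symmetric:
  assumes p: "p = 2" and a: "hermitian a" and f: "f \<in> rng" and g: "g \<in> rng"
  shows "(\<integral>x. T a f x * cnj (g x) \<partial>M) = cnj (\<integral>x. T a g x * cnj (f x) \<partial>M)"
proof -
  let ?X = "\<integral>x. T a f x * cnj (g x) \<partial>M" and ?Y = "\<integral>x. T a g x * cnj (f x) \<partial>M"
  have "Im (cnj c * ?X + c * ?Y) = 0" for c
    using hermitian_cross_terms [OF a f g, of c] unfolding p dualp_2 by (simp del: times_complex.sel)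
  from this [of 1] this [of \<i>] show ?thesis
    by (simp add: complex_eq_iff)
qed

lemma integral_cnj_mult:
  "(\<integral>x. cnj (f x) * g x \<partial>M) = cnj (\<integral>x. f x * cnj (g x) \<partial>M)"
  by (subst Bochner_Integration.integral_cnj [symmetric]) simp

text \<open>Symmetry moves one factor across the pairing and reduces both states to the pairing of
  \<open>T a f\<close> with \<open>T b f\<close>. It follows that \<open>a b + b a\<close> and
  \<open>\<i> (b a - a b)\<close> have real states.\<close>

lemma state_mult_commute:
  fixes a b :: 'a
  assumes p: "p = 2" and a: "hermitian a" and b: "hermitian b" and f: "f \<in> rng"
  shows "state f (b * a) = cnj (state f (a * b))"
proof -
  note fL = rng_Lp [OF f]
  have Tf: "T c f \<in> rng" for c by (intro T_in_rng fL)
  have state: "state f (c * d) = cnj (\<integral>x. T c f x * cnj (T d f x) \<partial>M)" if c: "hermitian c" for c d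
  proof -
    have "state f (c * d) = (\<integral>x. T c (T d f) x * dualp p (f x) \<partial>M)"
      unfolding state_def by (intro integral_cong_mult_dualp T_Lp fL T_mult)
    then show ?thesis
      using hermitian_symmetric [OF p c f Tf, of d] by (simp add: p dualp_2)
  qed
  show ?thesis
    unfolding state [OF a] state [OF b]
    using integral_cnj_mult [of "T a f" "T b f"] by (simp add: mult.commute)
qed

lemma integral_comb_mult_dualp:
  assumes "u \<in> Lp_fun p M" "v \<in> Lp_fun p M" "h \<in> Lp_fun p M"
  shows "(\<integral>x. (u x + c * v x) * dualp p (h x) \<partial>M) =
    (\<integral>x. u x * dualp p (h x) \<partial>M) + c * (\<integral>x. v x * dualp p (h x) \<partial>M)"
  using integrable_mult_dualp [OF p1 assms(1,3)] integrable_mult_dualp [OF p1 assms(2,3)]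
  by (simp add: distrib_right mult.assoc)

text \<open>On \<open>rng\<close>, \<open>a - \<i> b\<close> acts as the adjoint of
  \<open>a + \<i> b\<close>. If \<open>g\<close> is the image of \<open>f\<close> under the adjoint,
  then \<open>pint p M g\<close> is the pairing of \<open>(a + \<i> b) g\<close> with
  \<open>f\<close>, and the tangent bound takes the part of Cauchy-Schwarz.\<close>

lemma norm_hermitian_conjugate_le:
  fixes a b :: 'a
  assumes p: "p = 2" and a: "hermitian a" and b: "hermitian b"
  shows "norm (a + (- \<i>) *\<^sub>C b) \<le> norm (a + \<i> *\<^sub>C b)"
\<comment> \<open>A strict upper bound \<open>K\<close> is positive, so its square can be cancelled
  at the end even when the norm is 0.\<close>
proof (rule dense_ge)
  fix K assume K: "norm (a + \<i> *\<^sub>C b) < K"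
  then have K0: "0 < K" by (meson norm_ge_zero order_le_less_trans)
  show "norm (a + (- \<i>) *\<^sub>C b) \<le> K"
  proof (rule norm_le_of_rng)
    fix f assume f: "f \<in> rng"
    note fL = rng_Lp [OF f]
    define g where "g = T (a + (- \<i>) *\<^sub>C b) f"
    have g: "g \<in> rng" unfolding g_def by (rule T_in_rng [OF fL])
    note gL = rng_Lp [OF g]
    let ?z = "T (a + \<i> *\<^sub>C b) g"
    have zL: "?z \<in> Lp_fun p M" by (rule T_Lp [OF gL])
    have "of_real (pint p M g) = (\<integral>x. g x * dualp p (g x) \<partial>M)"
      by (simp add: integral_mult_dualp_self)
    also have "\<dots> = (\<integral>x. (T a f x + (- \<i>) * T b f x) * dualp p (g x) \<partial>M)"
    proof (rule integral_cong_mult_dualp)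
      show "AE x in M. g x = T a f x + (- \<i>) * T b f x"
        using T_add [OF fL, of a "(- \<i>) *\<^sub>C b"] T_scaleC [OF fL, of "- \<i>" b]
        unfolding g_def by eventually_elim simp
    qed (intro gL Lp_fun_add Lp_fun_scale T_Lp fL p0)+
    also have "\<dots> = (\<integral>x. T a f x * dualp p (g x) \<partial>M) + (- \<i>) * (\<integral>x. T b f x * dualp p (g x) \<partial>M)"
      by (intro integral_comb_mult_dualp T_Lp fL gL)
    also have "\<dots> = cnj ((\<integral>x. T a g x * dualp p (f x) \<partial>M) + \<i> * (\<integral>x. T b g x * dualp p (f x) \<partial>M))"
      using hermitian_symmetric [OF p a f g] hermitian_symmetric [OF p b f g] by (simp add: p dualp_2)
    also have "(\<integral>x. T a g x * dualp p (f x) \<partial>M) + \<i> * (\<integral>x. T b g x * dualp p (f x) \<partial>M) =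
        (\<integral>x. (T a g x + \<i> * T b g x) * dualp p (f x) \<partial>M)"
      by (rule integral_comb_mult_dualp [symmetric]) (intro T_Lp fL gL)+
    also have "\<dots> = (\<integral>x. ?z x * dualp p (f x) \<partial>M)"
      by (rule integral_cong_mult_dualp [symmetric])
        (intro T_add_ii zL Lp_fun_add Lp_fun_scale T_Lp fL gL p0)+
    finally have pint_g: "Re (\<integral>x. ?z x * dualp p (f x) \<partial>M) = pint p M g"
      by (metis Re_complex_of_real complex_cnj_cnj complex_cnj_complex_of_real)
    \<comment> \<open>The base point \<open>K^2 f\<close> is chosen so that, with F and G the values
      of \<open>pint\<close> at \<open>f\<close> and \<open>g\<close>, the bounds read
      \<open>2 K^2 G - K^4 F \<le> pint ?z \<le> K^2 G\<close>, that is,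
      \<open>G \<le> K^2 F\<close>.\<close>
    let ?k = "complex_of_real (K\<^sup>2)"
    have kL: "(\<lambda>x. ?k * f x) \<in> Lp_fun p M"
      by (intro Lp_fun_scale fL p0)
    have cmod_k: "cmod ?k powr 2 = K\<^sup>2 * K\<^sup>2"
      unfolding norm_of_real by (simp add: power2_eq_square)
    have dk: "dualp p (?k * w) = ?k * dualp p w" for w
      by (simp add: p dualp_2)
    have "(\<integral>x. (?z x - ?k * f x) * dualp p (?k * f x) \<partial>M) =
        (\<integral>x. ?k * (?z x * dualp p (f x)) - (?k * ?k) * (f x * dualp p (f x)) \<partial>M)"
      unfolding dk by (simp add: algebra_simps)
    also have "\<dots> = ?k * (\<integral>x. ?z x * dualp p (f x) \<partial>M) - (?k * ?k) * of_real (pint p M f)"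
      using integrable_mult_dualp [OF p1 zL fL] integrable_mult_dualp [OF p1 fL fL]
      by (simp add: integral_mult_dualp_self)
    finally have "Re (\<integral>x. (?z x - ?k * f x) * dualp p (?k * f x) \<partial>M) =
        K\<^sup>2 * pint p M g - K\<^sup>2 * K\<^sup>2 * pint p M f"
      using pint_g by (simp flip: of_real_power of_real_mult)
    then have "K\<^sup>2 * K\<^sup>2 * pint p M f + 2 * (K\<^sup>2 * pint p M g - K\<^sup>2 * K\<^sup>2 * pint p M f) \<le> pint p M ?z"
      using pint_tangent [OF p1 kL zL] cmod_k by (simp only: pint_scale p)
    also have "\<dots> \<le> norm (a + \<i> *\<^sub>C b) powr p * pint p M g"
      by (rule T_bound [OF gL])
    also have "\<dots> \<le> K powr p * pint p M g"
      using K p0 by (intro mult_right_mono powr_mono2 pint_nonneg) auto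
    also have "K powr p = K\<^sup>2" using K0 by (simp add: p)
    finally have "K\<^sup>2 * pint p M g \<le> K\<^sup>2 * (K\<^sup>2 * pint p M f)"
      by (simp add: algebra_simps)
    moreover have "0 < K\<^sup>2" using K0 by simp
    ultimately have "pint p M g \<le> K\<^sup>2 * pint p M f"
      by (simp only: mult_le_cancel_left_pos)
    then show "pint p M (T (a + (- \<i>) *\<^sub>C b) f) \<le> K powr p * pint p M f"
      using K0 by (simp add: p flip: g_def)
  qed (use K0 in simp)
qed

end

section \<open>The core\<close>

context Lp_representation
begin

text \<open>Needed for closedness of the core. For \<open>p = 2\<close>, \<open>2 a\<close> is the
  sum of \<open>a + \<i> b\<close> and \<open>a - \<i> b\<close>, and the second is no longer than
  the first.\<close>

lemma norm_hermitian_part_le: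
  fixes a b :: 'a
  assumes a: "hermitian a" and b: "hermitian b"
  shows "norm a \<le> norm (a + \<i> *\<^sub>C b)"
proof (cases "p = 2")
  case True
  have "(a + \<i> *\<^sub>C b) + (a + (- \<i>) *\<^sub>C b) = 2 *\<^sub>R a + (\<i> + - \<i>) *\<^sub>C b"
    unfolding scaleC_add_left by (simp add: scaleR_2)
  then have "2 *\<^sub>R a = (a + \<i> *\<^sub>C b) + (a + (- \<i>) *\<^sub>C b)" by simp
  then have "2 * norm a = norm ((a + \<i> *\<^sub>C b) + (a + (- \<i>) *\<^sub>C b))"
    by (metis abs_numeral norm_scaleR)
  also have "\<dots> \<le> norm (a + \<i> *\<^sub>C b) + norm (a + (- \<i>) *\<^sub>C b)"
    by (rule norm_triangle_ineq)
  finally show ?thesis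
    using norm_hermitian_conjugate_le [OF True a b] by simp
qed (rule norm_hermitian_part_le_not_2 [OF _ a b])

lemma core_UNIV_iff: "z \<in> core (UNIV :: 'a set) \<longleftrightarrow> (\<exists>x y. hermitian x \<and> hermitian y \<and> z = x + \<i> *\<^sub>C y)"
  by (auto simp: core_def hermitian_elements_def)

lemma hermitian_0: "hermitian (0 :: 'a)"
  using hermitian_scaleR [OF hermitian_1, of 0] by simp

lemma hermitian_in_core: "hermitian a \<Longrightarrow> a \<in> core (UNIV :: 'a set)"
  unfolding core_UNIV_iff using hermitian_0 by (metis add.right_neutral scaleC_zero_right)

lemma core_add:
  assumes "z \<in> core (UNIV :: 'a set)" "w \<in> core UNIV"
  shows "z + w \<in> core UNIV"
proof -
  from assms obtain x y x' y' where h: "hermitian x" "hermitian y" "hermitian x'" "hermitian y'"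
    and z: "z = x + \<i> *\<^sub>C y" "w = x' + \<i> *\<^sub>C y'"
    unfolding core_UNIV_iff by blast
  have "z + w = (x + x') + \<i> *\<^sub>C (y + y')"
    by (simp add: z scaleC_add_right)
  then show ?thesis
    unfolding core_UNIV_iff using h hermitian_add by blast
qed

lemma core_scaleC:
  assumes "z \<in> core (UNIV :: 'a set)"
  shows "c *\<^sub>C z \<in> core UNIV"
proof -
  from assms obtain x y where h: "hermitian x" "hermitian y" and z: "z = x + \<i> *\<^sub>C y"
    unfolding core_UNIV_iff by blast
  have c: "c = of_real (Re c) + \<i> * of_real (Im c)" "c * \<i> = of_real (- Im c) + \<i> * of_real (Re c)"
    by (simp_all add: complex_eq_iff)
  have "c *\<^sub>C z = c *\<^sub>C x + (c * \<i>) *\<^sub>C y"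
    by (simp add: z scaleC_add_right scaleC_scaleC)
  also have "c *\<^sub>C x = Re c *\<^sub>R x + \<i> *\<^sub>C (Im c *\<^sub>R x)"
    by (subst c(1)) (simp only: scaleC_add_left flip: scaleC_of_real scaleC_scaleC)
  also have "(c * \<i>) *\<^sub>C y = (- Im c) *\<^sub>R y + \<i> *\<^sub>C (Re c *\<^sub>R y)"
    by (subst c(2)) (simp only: scaleC_add_left flip: scaleC_of_real scaleC_scaleC)
  finally have "c *\<^sub>C z = (Re c *\<^sub>R x + (- Im c) *\<^sub>R y) + \<i> *\<^sub>C (Im c *\<^sub>R x + Re c *\<^sub>R y)"
    by (simp add: scaleC_add_right)
  then show ?thesis
    unfolding core_UNIV_iff using h hermitian_add hermitian_scaleR by blast
qed

lemma hermitian_mult_in_core: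
  fixes a b :: 'a
  assumes a: "hermitian a" and b: "hermitian b"
  shows "a * b \<in> core UNIV"
proof (cases "p = 2")
  case True
  define x y where "x = a * b + b * a" and "y = (- \<i>) *\<^sub>C (a * b) + \<i> *\<^sub>C (b * a)"
  have "hermitian x" "hermitian y"
    unfolding hermitian_iff_state x_def y_def
    using state_mult_commute [OF True a b] by (simp_all add: state_add state_scaleC rng_Lp)
  then have "of_real (1 / 2) *\<^sub>C (x + \<i> *\<^sub>C y) \<in> core UNIV"
    by (intro core_scaleC) (auto simp: core_UNIV_iff)
  moreover have "of_real (1 / 2) *\<^sub>C (x + \<i> *\<^sub>C y) = a * b"
  proof -
    have "(- 1) *\<^sub>C (b * a) = - (b * a)"
      using scaleC_of_real [of "-1" "b * a"] by simp
    then have "x + \<i> *\<^sub>C y = 2 *\<^sub>R (a * b)"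
      by (simp add: x_def y_def scaleC_add_right scaleC_scaleC scaleR_2)
    then show ?thesis by (simp only: scaleC_of_real) simp
  qed
  ultimately show ?thesis by simp
qed (intro hermitian_in_core hermitian_mult a b)

lemma core_mult:
  assumes "z \<in> core (UNIV :: 'a set)" "w \<in> core UNIV"
  shows "z * w \<in> core UNIV"
proof -
  from assms obtain x y x' y' where h: "hermitian x" "hermitian y" "hermitian x'" "hermitian y'"
    and z: "z = x + \<i> *\<^sub>C y" "w = x' + \<i> *\<^sub>C y'"
    unfolding core_UNIV_iff by blast
  have "z * w = x * x' + \<i> *\<^sub>C (x * y') + (\<i> *\<^sub>C (y * x') + \<i> *\<^sub>C \<i> *\<^sub>C (y * y'))"
    by (simp add: z distrib_left distrib_right mult_scaleC_left mult_scaleC_right scaleC_add_right)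
  then show ?thesis
    using h by (simp add: core_add core_scaleC hermitian_mult_in_core)
qed

text \<open>By \<open>norm_hermitian_part_le\<close> the hermitian parts \<open>x n\<close> of a
  convergent sequence form a Cauchy sequence. The parts \<open>y n\<close> are recovered as
  \<open>- \<i> (s n - x n)\<close>, and limits of hermitian elements are hermitian.\<close>

lemma closed_core: "closed (core (UNIV :: 'a set))"
  unfolding closed_sequential_limits
proof (intro allI impI, elim conjE)
  fix s :: "nat \<Rightarrow> 'a" and l
  assume s: "\<forall>n. s n \<in> core UNIV" and l: "s \<longlonglongrightarrow> l"
  then obtain x y where h: "\<And>n. hermitian (x n)" "\<And>n. hermitian (y n)" and xy: "\<And>n. s n = x n + \<i> *\<^sub>C y n"
    unfolding core_UNIV_iff by metis
  have minus: "hermitian (a - b)" if "hermitian a" "hermitian b" for a b :: 'a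
    using hermitian_add [OF that(1) hermitian_scaleR [OF that(2), of "-1"]] by simp
  have minusC: "c *\<^sub>C (a - b) = c *\<^sub>C a - c *\<^sub>C b" for c and a b :: 'a
    using scaleC_add_right [of c "a - b" b] by (simp add: algebra_simps)
  have le: "dist (x m) (x n) \<le> dist (s m) (s n)" for m n
  proof -
    have "s m - s n = (x m - x n) + \<i> *\<^sub>C (y m - y n)"
      by (simp add: xy minusC)
    then show ?thesis
      unfolding dist_norm using norm_hermitian_part_le [OF minus minus, OF h(1) h(1) h(2) h(2)] by metis
  qed
  have "Cauchy s"
    using l by (simp add: LIMSEQ_imp_Cauchy)
  then have "Cauchy x"
    unfolding Cauchy_def using le by (meson order_le_less_trans)
  then obtain u where u: "x \<longlonglongrightarrow> u"
    using Cauchy_convergent convergent_def by blast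
  have "bounded_linear ((*\<^sub>C) (- \<i>) :: 'a \<Rightarrow> 'a)"
    by (rule bounded_linear_intro [where K = 1])
      (simp_all add: scaleC_add_right norm_scaleC scaleC_scaleC mult.commute flip: scaleC_of_real)
  from bounded_linear.tendsto [OF this tendsto_diff [OF l u]]
  have "(\<lambda>n. (- \<i>) *\<^sub>C (s n - x n)) \<longlonglongrightarrow> (- \<i>) *\<^sub>C (l - u)" .
  moreover have "(\<lambda>n. (- \<i>) *\<^sub>C (s n - x n)) = y"
    by (rule ext) (simp only: xy add_diff_cancel_left' scaleC_scaleC, simp)
  ultimately have "y \<longlonglongrightarrow> (- \<i>) *\<^sub>C (l - u)"
    by (simp only:)
  then have "hermitian ((- \<i>) *\<^sub>C (l - u))"
    by (rule hermitian_limit [OF h(2)])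
  moreover have "hermitian u"
    by (rule hermitian_limit [OF h(1) u])
  moreover have "l = u + \<i> *\<^sub>C (- \<i>) *\<^sub>C (l - u)"
    by (simp add: scaleC_scaleC)
  ultimately show "l \<in> core UNIV"
    unfolding core_UNIV_iff by blast
qed

lemma unital_Cstar_subalgebra_core: "unital_Cstar_subalgebra (core (UNIV :: 'a set))"
proof -
  \<comment> \<open>\<open>hermitian\<close> refers to the ambient algebra, so the core contains
    every hermitian element and forming the core again changes nothing.\<close>
  have "hermitian_elements (core UNIV) = {a :: 'a. hermitian a}"
    by (auto simp: hermitian_elements_def intro: hermitian_in_core)
  then have "core (core UNIV) = core (UNIV :: 'a set)"
    by (simp add: core_def hermitian_elements_def)
  then show ?thesis
    unfolding unital_Cstar_subalgebra_def unital_closed_subalgebra_def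
    by (simp add: closed_core core_add core_mult core_scaleC hermitian_in_core hermitian_1)
qed

lemma core_commute:
  assumes p: "p \<noteq> 2" and "z \<in> core (UNIV :: 'a set)" "w \<in> core UNIV"
  shows "z * w = w * z"
proof -
  from assms obtain x y x' y' where h: "hermitian x" "hermitian y" "hermitian x'" "hermitian y'"
    and z: "z = x + \<i> *\<^sub>C y" "w = x' + \<i> *\<^sub>C y'"
    unfolding core_UNIV_iff by blast
  show ?thesis
    using hermitian_commute [OF p h(1) h(3)] hermitian_commute [OF p h(1) h(4)]
      hermitian_commute [OF p h(2) h(3)] hermitian_commute [OF p h(2) h(4)]
    by (simp add: z distrib_left distrib_right mult_scaleC_left mult_scaleC_right scaleC_add_right)
qed

end

lemma unital_Cstar_subalgebra_le_core:
  "unital_Cstar_subalgebra B \<Longrightarrow> B \<subseteq> core UNIV"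
  unfolding unital_Cstar_subalgebra_def core_def hermitian_elements_def by blast

section \<open>From classes modulo null sets to functions\<close>

abbreviation Lp_class :: "real \<Rightarrow> 'x measure \<Rightarrow> ('x \<Rightarrow> complex) \<Rightarrow> ('x \<Rightarrow> complex) set" where
  "Lp_class p M f \<equiv> Lp_rel p M `` {f}"

lemma equiv_Lp_rel: "equiv (Lp_fun p M) (Lp_rel p M)"
proof (rule equivI)
  show "Lp_rel p M \<subseteq> Lp_fun p M \<times> Lp_fun p M"
    by (auto simp: Lp_rel_def)
  show "refl_on (Lp_fun p M) (Lp_rel p M)"
    by (auto simp: Lp_rel_def refl_on_def)
  show "sym (Lp_rel p M)"
    by (auto simp: Lp_rel_def sym_def elim: eventually_mono)
  show "trans (Lp_rel p M)"
    by (auto simp: Lp_rel_def trans_def elim: eventually_elim2)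
qed

lemma Lp_class_eq_iff:
  "f \<in> Lp_fun p M \<Longrightarrow> g \<in> Lp_fun p M \<Longrightarrow> Lp_class p M f = Lp_class p M g \<longleftrightarrow> (AE x in M. f x = g x)"
  using eq_equiv_class_iff [OF equiv_Lp_rel, of f p M g] by (auto simp: Lp_rel_def)

lemma Lp_class_in_space: "f \<in> Lp_fun p M \<Longrightarrow> Lp_class p M f \<in> Lp_space p M"
  by (simp add: Lp_space_def quotientI)

lemma mem_Lp_class: "f \<in> Lp_fun p M \<Longrightarrow> g \<in> Lp_class p M f \<longleftrightarrow> g \<in> Lp_fun p M \<and> (AE x in M. f x = g x)"
  by (auto simp: Lp_rel_def)

lemma Lp_class_self: "f \<in> Lp_fun p M \<Longrightarrow> f \<in> Lp_class p M f"
  by (simp add: mem_Lp_class del: Image_singleton_iff)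

lemma Lp_spaceE:
  assumes "X \<in> Lp_space p M"
  obtains f where "f \<in> Lp_fun p M" "X = Lp_class p M f"
  using assms unfolding Lp_space_def by (elim quotientE)

lemma Lp_space_mem:
  assumes "X \<in> Lp_space p M" "f \<in> X"
  shows "f \<in> Lp_fun p M" "X = Lp_class p M f"
proof -
  from assms(1) obtain g where g: "g \<in> Lp_fun p M" "X = Lp_class p M g"
    by (rule Lp_spaceE)
  then have f: "f \<in> Lp_fun p M" "AE x in M. g x = f x"
    using assms(2) mem_Lp_class by blast+
  show "f \<in> Lp_fun p M" by (rule f)
  show "X = Lp_class p M f"
    using Lp_class_eq_iff [OF g(1) f(1)] f(2) g(2) by simp
qed

lemma Lp_add_class:
  assumes p: "0 \<le> p" and f: "f \<in> Lp_fun p M" and g: "g \<in> Lp_fun p M"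
  shows "Lp_add p M (Lp_class p M f) (Lp_class p M g) = Lp_class p M (\<lambda>x. f x + g x)"
proof -
  have "Lp_class p M (\<lambda>x. u x + v x) = Lp_class p M (\<lambda>x. f x + g x)"
    if "u \<in> Lp_class p M f" "v \<in> Lp_class p M g" for u v
  proof (subst Lp_class_eq_iff)
    have uv: "u \<in> Lp_fun p M" "v \<in> Lp_fun p M" "AE x in M. f x = u x" "AE x in M. g x = v x"
      using that mem_Lp_class f g by blast+
    then show "(\<lambda>x. u x + v x) \<in> Lp_fun p M" by (intro Lp_fun_add p)
    show "(\<lambda>x. f x + g x) \<in> Lp_fun p M" by (intro Lp_fun_add p f g)
    show "AE x in M. u x + v x = f x + g x"
      using uv(3,4) by eventually_elim simp
  qed
  moreover have "f \<in> Lp_class p M f" "g \<in> Lp_class p M g"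
    by (intro Lp_class_self f g)+
  ultimately show ?thesis
    unfolding Lp_add_def by blast
qed

lemma Lp_scale_class:
  assumes p: "0 \<le> p" and f: "f \<in> Lp_fun p M"
  shows "Lp_scale p M c (Lp_class p M f) = Lp_class p M (\<lambda>x. c * f x)"
proof -
  have "Lp_class p M (\<lambda>x. c * u x) = Lp_class p M (\<lambda>x. c * f x)" if "u \<in> Lp_class p M f" for u
  proof (subst Lp_class_eq_iff)
    have u: "u \<in> Lp_fun p M" "AE x in M. f x = u x"
      using that mem_Lp_class f by blast+
    then show "(\<lambda>x. c * u x) \<in> Lp_fun p M" by (intro Lp_fun_scale p)
    show "(\<lambda>x. c * f x) \<in> Lp_fun p M" by (intro Lp_fun_scale p f)
    show "AE x in M. c * u x = c * f x"
      using u(2) by eventually_elim simp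
  qed
  moreover have "f \<in> Lp_class p M f"
    by (rule Lp_class_self [OF f])
  ultimately show ?thesis
    unfolding Lp_scale_def by blast
qed

lemma Lp_norm_class:
  assumes f: "f \<in> Lp_fun p M"
  shows "Lp_norm p M (Lp_class p M f) = pint p M f powr (1 / p)"
proof -
  have "pint p M g = pint p M f" if "g \<in> Lp_class p M f" for g
    using that mem_Lp_class [OF f, of g] f by (intro pint_cong_AE) (auto elim: eventually_mono)
  then have "(\<lambda>f. pint p M f powr (1 / p)) ` Lp_class p M f = (\<lambda>_. pint p M f powr (1 / p)) ` Lp_class p M f"
    by (intro image_cong refl) simp
  also have "\<dots> = {pint p M f powr (1 / p)}"
    by (rule image_constant [OF Lp_class_self [OF f]])
  finally have "(\<lambda>f. pint p M f powr (1 / p)) ` Lp_class p M f = {pint p M f powr (1 / p)}" .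
  then show ?thesis
    by (simp add: Lp_norm_def flip: pint_def)
qed


text \<open>\<open>T a f\<close> is an arbitrary representative of the image class, so identities
  between classes become identities almost everywhere. Isometry splits into \<open>T_bound\<close>,
  as the supremum bounds every quotient, and \<open>norm_le\<close>, as it is the least
  bound.\<close>

lemma Lp_representation_of_isometric:
  fixes \<phi> :: "'a::complex_banach_algebra_1 \<Rightarrow> ('x \<Rightarrow> complex) set \<Rightarrow> ('x \<Rightarrow> complex) set"
  assumes p: "1 \<le> p" and \<phi>: "isometric_representation p M \<phi>"
  shows "Lp_representation p M (\<lambda>a f. SOME g. g \<in> \<phi> a (Lp_class p M f))"
proof -
  define T where "T = (\<lambda>a f. SOME g. g \<in> \<phi> a (Lp_class p M f))"
  have p0: "0 \<le> p" "0 < p" using p by auto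
  note \<phi>' = \<phi> [unfolded isometric_representation_def]
  have bounded: "Lp_bounded_operator p M (\<phi> a)" for a
    using \<phi>' by blast
  have in_space: "\<phi> a X \<in> Lp_space p M" if "X \<in> Lp_space p M" for a X
    using bounded that unfolding Lp_bounded_operator_def by blast
  have T_rep: "T a f \<in> Lp_fun p M" "\<phi> a (Lp_class p M f) = Lp_class p M (T a f)"
    if f: "f \<in> Lp_fun p M" for a f
  proof -
    have X: "\<phi> a (Lp_class p M f) \<in> Lp_space p M"
      by (intro in_space Lp_class_in_space f)
    then have "T a f \<in> \<phi> a (Lp_class p M f)"
      unfolding T_def by (metis Lp_class_self Lp_spaceE someI_ex)
    then show "T a f \<in> Lp_fun p M" "\<phi> a (Lp_class p M f) = Lp_class p M (T a f)"
      using Lp_space_mem [OF X] by blast+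
  qed
  have AE_eq: "AE x in M. u x = v x"
    if "Lp_class p M u = Lp_class p M v" "u \<in> Lp_fun p M" "v \<in> Lp_fun p M" for u v
    using that Lp_class_eq_iff by blast
  have norm: "Lp_norm p M (\<phi> a (Lp_class p M f)) = pint p M (T a f) powr (1 / p)" if "f \<in> Lp_fun p M" for a f
    using T_rep [OF that, of a] by (simp add: Lp_norm_class)
  have root: "(x powr (1 / p)) powr p = x" if "0 \<le> x" for x :: real
    using that p0 by (simp add: powr_powr)
  have onorm: "Lp_onorm p M (\<phi> a) = norm a" for a
    using \<phi>' by blast
  have "Lp_representation p M T"
  proof
    show "1 \<le> p" by fact
    show "T a f \<in> Lp_fun p M" if "f \<in> Lp_fun p M" for a f
      by (rule T_rep(1) [OF that])
  next
    fix a f g assume f: "f \<in> Lp_fun p M" and g: "g \<in> Lp_fun p M"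
    have "Lp_class p M (T a (\<lambda>x. f x + g x)) = \<phi> a (Lp_add p M (Lp_class p M f) (Lp_class p M g))"
      by (simp only: Lp_add_class [OF p0(1) f g] T_rep(2) [OF Lp_fun_add [OF f g p0(1)]])
    also have "\<dots> = Lp_add p M (\<phi> a (Lp_class p M f)) (\<phi> a (Lp_class p M g))"
      using bounded [of a] Lp_class_in_space [OF f] Lp_class_in_space [OF g]
      unfolding Lp_bounded_operator_def by blast
    also have "\<dots> = Lp_class p M (\<lambda>x. T a f x + T a g x)"
      by (simp only: T_rep(2) f g Lp_add_class [OF p0(1)] T_rep(1))
    finally show "AE x in M. T a (\<lambda>x. f x + g x) x = T a f x + T a g x"
      by (rule AE_eq) (intro T_rep(1) Lp_fun_add f g p0)+
  next
    fix a c f assume f: "f \<in> Lp_fun p M"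
    have "Lp_class p M (T a (\<lambda>x. c * f x)) = \<phi> a (Lp_scale p M c (Lp_class p M f))"
      by (simp only: Lp_scale_class [OF p0(1) f] T_rep(2) [OF Lp_fun_scale [OF f p0(1)]])
    also have "\<dots> = Lp_scale p M c (\<phi> a (Lp_class p M f))"
      using bounded [of a] Lp_class_in_space [OF f] unfolding Lp_bounded_operator_def by blast
    also have "\<dots> = Lp_class p M (\<lambda>x. c * T a f x)"
      by (simp only: T_rep(2) f Lp_scale_class [OF p0(1)] T_rep(1))
    finally show "AE x in M. T a (\<lambda>x. c * f x) x = c * T a f x"
      by (rule AE_eq) (intro T_rep(1) Lp_fun_scale f p0)+
  next
    fix a b f assume f: "f \<in> Lp_fun p M"
    have "Lp_class p M (T (a + b) f) = Lp_add p M (\<phi> a (Lp_class p M f)) (\<phi> b (Lp_class p M f))"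
      using \<phi>' Lp_class_in_space [OF f] T_rep(2) [OF f] by metis
    also have "\<dots> = Lp_class p M (\<lambda>x. T a f x + T b f x)"
      by (simp only: T_rep(2) f Lp_add_class [OF p0(1)] T_rep(1))
    finally show "AE x in M. T (a + b) f x = T a f x + T b f x"
      by (rule AE_eq) (intro T_rep(1) Lp_fun_add f p0)+
  next
    fix c a f assume f: "f \<in> Lp_fun p M"
    have "Lp_class p M (T (c *\<^sub>C a) f) = Lp_scale p M c (\<phi> a (Lp_class p M f))"
      using \<phi>' Lp_class_in_space [OF f] T_rep(2) [OF f] by metis
    also have "\<dots> = Lp_class p M (\<lambda>x. c * T a f x)"
      by (simp only: T_rep(2) f Lp_scale_class [OF p0(1)] T_rep(1))
    finally show "AE x in M. T (c *\<^sub>C a) f x = c * T a f x"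
      by (rule AE_eq) (intro T_rep(1) Lp_fun_scale f p0)+
  next
    fix a b f assume f: "f \<in> Lp_fun p M"
    have "Lp_class p M (T (a * b) f) = \<phi> a (\<phi> b (Lp_class p M f))"
      using \<phi>' Lp_class_in_space [OF f] T_rep(2) [OF f] by metis
    also have "\<dots> = Lp_class p M (T a (T b f))"
      by (simp only: T_rep(2) f T_rep(1))
    finally show "AE x in M. T (a * b) f x = T a (T b f) x"
      by (rule AE_eq) (intro T_rep(1) f)+
  next
    fix a f assume f: "f \<in> Lp_fun p M"
    let ?X = "Lp_class p M f"
    obtain K where K: "\<And>X. X \<in> Lp_space p M \<Longrightarrow> Lp_norm p M (\<phi> a X) \<le> K * Lp_norm p M X"
      using bounded [of a] unfolding Lp_bounded_operator_def by blast
    have nonneg: "0 \<le> Lp_norm p M X" if "X \<in> Lp_space p M" for X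
      using that by (auto elim!: Lp_spaceE simp: Lp_norm_class)
    have "Lp_norm p M (\<phi> a ?X) \<le> norm a * Lp_norm p M ?X"
    \<comment> \<open>For the zero class the quotient in \<open>Lp_onorm\<close> is 0 / 0 = 0 and
      carries no information; the constant \<open>K\<close> from boundedness settles this
      case.\<close>
    proof (cases "Lp_norm p M ?X = 0")
      case True
      then show ?thesis using K [OF Lp_class_in_space [OF f]] by simp
    next
      case False
      then have pos: "0 < Lp_norm p M ?X"
        using nonneg [OF Lp_class_in_space [OF f]] by simp
      \<comment> \<open>The absolute value keeps the bound valid where the quotient is 0 / 0 = 0.
        Only for a bounded set of quotients does the supremum in \<open>Lp_onorm\<close> dominate
        its members.\<close>
      have "Lp_norm p M (\<phi> a X) / Lp_norm p M X \<le> \<bar>K\<bar>" if X: "X \<in> Lp_space p M" for X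
      proof (cases "Lp_norm p M X = 0")
        case False
        then have "Lp_norm p M (\<phi> a X) / Lp_norm p M X \<le> K"
          using K [OF X] nonneg [OF X] by (simp add: divide_le_eq)
        then show ?thesis by simp
      qed simp
      then have "bdd_above ((\<lambda>X. Lp_norm p M (\<phi> a X) / Lp_norm p M X) ` Lp_space p M)"
        by (rule bdd_aboveI2)
      from cSUP_upper [OF Lp_class_in_space [OF f] this]
      have "Lp_norm p M (\<phi> a ?X) / Lp_norm p M ?X \<le> norm a"
        using onorm [of a] by (simp add: Lp_onorm_def)
      then show ?thesis using pos by (simp add: divide_le_eq)
    qed
    then have "(pint p M (T a f) powr (1 / p)) powr p \<le> (norm a * pint p M f powr (1 / p)) powr p"
      using p0 unfolding norm [OF f] Lp_norm_class [OF f] by (intro powr_mono2) auto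
    then show "pint p M (T a f) \<le> norm a powr p * pint p M f"
      by (simp add: powr_mult root pint_nonneg del: powr_powr)
  next
    fix a K assume K: "0 \<le> K"
      and bound: "\<And>f. f \<in> Lp_fun p M \<Longrightarrow> pint p M (T a f) \<le> K powr p * pint p M f"
    have inv: "(x powr p) powr (1 / p) = x" if "0 \<le> x" for x :: real
      using that p0 by (simp add: powr_powr)
    have "Lp_onorm p M (\<phi> a) \<le> K"
      unfolding Lp_onorm_def
    proof (rule cSUP_least)
      have "(\<lambda>x. 0) \<in> Lp_fun p M" by (simp add: Lp_fun_def)
      then show "Lp_space p M \<noteq> {}" using Lp_class_in_space by blast
      fix X assume "X \<in> Lp_space p M"
      then obtain f where f: "f \<in> Lp_fun p M" and X: "X = Lp_class p M f" by (rule Lp_spaceE)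
      have "pint p M (T a f) powr (1 / p) \<le> (K powr p * pint p M f) powr (1 / p)"
        using p0 by (intro powr_mono2 bound f pint_nonneg) auto
      then have "Lp_norm p M (\<phi> a X) \<le> K * Lp_norm p M X"
        unfolding X norm [OF f] Lp_norm_class [OF f] by (simp add: powr_mult inv K del: powr_powr)
      moreover have "0 \<le> Lp_norm p M X"
        unfolding X Lp_norm_class [OF f] by simp
      ultimately show "Lp_norm p M (\<phi> a X) / Lp_norm p M X \<le> K"
        using K by (cases "Lp_norm p M X = 0") (auto simp: divide_le_eq)
    qed
    then show "norm a \<le> K" by (simp add: onorm)
  qed
  then show ?thesis by (simp only: T_def)
qed

theorem theoremA:
  fixes p :: real and M :: "'x measure"
    and \<phi> :: "'a::complex_banach_algebra_1 \<Rightarrow> ('x \<Rightarrow> complex) set \<Rightarrow> ('x \<Rightarrow> complex) set"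
  assumes "1 \<le> p"
    and "isometric_representation p M \<phi>"
  shows "unital_Cstar_subalgebra (core (UNIV :: 'a set)) \<and>
    (\<forall>B :: 'a set. unital_Cstar_subalgebra B \<longrightarrow> B \<subseteq> core UNIV) \<and>
    (\<forall>B :: 'a set.
       (unital_Cstar_subalgebra B \<and> (\<forall>C. unital_Cstar_subalgebra C \<and> B \<subseteq> C \<longrightarrow> C = B))
         \<longleftrightarrow> B = core UNIV) \<and>
    (p \<noteq> 2 \<longrightarrow> (\<forall>x \<in> core (UNIV :: 'a set). \<forall>y \<in> core UNIV. x * y = y * x))"
proof -
  interpret Lp_representation p M "\<lambda>a f. SOME g. g \<in> \<phi> a (Lp_class p M f)"
    by (rule Lp_representation_of_isometric [OF assms])
  show ?thesis
    \<comment> \<open>Being the greatest unital C*-subalgebra, the core is also the only maximal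
      one.\<close>
    using unital_Cstar_subalgebra_core unital_Cstar_subalgebra_le_core core_commute by blast
qed

end
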